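(* Let $\zeta$ be the Riemann zeta function. For all real $\sigma\le-1$ and all real $t$ with $|t|\ge\tfrac12$, $$|\zeta(\sigma+it)|\le 2(2\pi)^{\sigma}\bigl\{(1-\sigma)^2+t^2\bigr\}^{\frac14-\frac{\sigma}{2}}.$$ *)

theory Defs
  imports "HOL-Complex_Analysis.Complex_Analysis"
begin

text \<open>
  \<open>f\<close> is a continuation of the Dirichlet series \<open>\<Sum>n\<ge>1. n\<^sup>-\<^sup>s\<close> to \<open>\<complex> - {1}\<close>.
  The value at the pole is fixed to 0, so that \<open>f\<close> is unique as a total function.
\<close>
definition zeta_continuation :: "(complex \<Rightarrow> complex) \<Rightarrow> bool" where
  "zeta_continuation f \<longleftrightarrow>
     f holomorphic_on (- {1}) \<and> f 1 = 0 \<and>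
     (\<forall>s. Re s > 1 \<longrightarrow> (\<lambda>n. 1 / of_nat (Suc n) powr s) sums f s)"

definition zeta :: "complex \<Rightarrow> complex" where
  "zeta = (THE f. zeta_continuation f)"

lemma zeta_continuation_unique:
  assumes f: "zeta_continuation f" and g: "zeta_continuation g"
  shows "f = g"
proof
  fix s :: complex
  have eq: "f z = g z" if "z \<in> {z. Re z > 1}" for z
    using f g that unfolding zeta_continuation_def by (auto intro: sums_unique2)
  have conn: "connected (- {1 :: complex})"
    by (rule connected_punctured_universe) simp
  show "f s = g s"
  proof (cases "s = 1")
    case True
    then show ?thesis using f g by (simp add: zeta_continuation_def)
  next
    case False
    show ?thesis
    proof (rule analytic_continuation_open[of "{z. Re z > 1}" "- {1}" f g])
      have "(2 :: complex) \<in> {z. Re z > 1}" by simp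
      then show "{z :: complex. Re z > 1} \<noteq> {}" by blast
    qed (use f g eq conn False in \<open>auto simp: zeta_continuation_def open_halfspace_Re_gt\<close>)
  qed
qed

lemma zeta_eqI: "zeta_continuation f \<Longrightarrow> zeta = f"
  unfolding zeta_def by (rule the_equality) (auto intro: zeta_continuation_unique)

end

theory Submission
  imports Defs "HOL-Real_Asymp.Real_Asymp"
begin

text \<open>
  Let \<open>T\<^sub>n(s)\<close> be the error of the trapezoidal rule for \<open>\<integral> u\<^sup>-\<^sup>s du\<close> on \<open>[n, n + 1]\<close>. The series
  \<open>\<Sum>n\<ge>0. T\<^sub>n(s)\<close> converges for \<open>Re s > -1\<close> and continues \<open>\<zeta>\<close> there. For real \<open>-1 < a < 0\<close> each
  \<open>T\<^sub>n(a)\<close> is a Mellin transform of a function of constant sign, and summing over \<open>n\<close> gives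
  \<open>\<Gamma>(a) \<zeta>(a) = \<integral> x\<^sup>a\<^sup>-\<^sup>1 (coth(x/2)/2 - 1/x) dx\<close> over \<open>x > 0\<close>. Expanding \<open>coth\<close> into partial
  fractions and integrating termwise yields the functional equation on \<open>(-1, 0)\<close>, hence on the strip
  \<open>-1 < Re s < 0\<close>; its right-hand side continues \<open>\<zeta>\<close> to \<open>Re s < 0\<close>.

  For \<open>w = 1 - s\<close> with \<open>Re w \<ge> 2\<close>, a non-asymptotic form of Stirling's formula bounds
  \<open>\<bar>\<Gamma>(w)\<bar>\<close> by \<open>e\<^sup>9\<^sup>/\<^sup>8 \<bar>w\<bar>\<close> to the power \<open>Re w - 1/2\<close>, times \<open>exp(-\<pi>\<bar>t\<bar>/2)\<close>. The last factor absorbs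
  \<open>\<bar>sin(\<pi>s/2)\<bar>\<close>, the Dirichlet series is at most \<open>\<pi>\<^sup>2/6\<close>, and \<open>e\<^sup>9\<^sup>/\<^sup>8 \<pi>\<^sup>2/6 \<le> 2\<pi>\<close>.
\<close>

subsection \<open>Euler-Maclaurin continuation to \<open>Re s > -1\<close>\<close>

text \<open>Two integrations by parts against the Peano kernel \<open>v * (1 - v) / 2\<close>, which
  vanishes at both ends and has second derivative \<open>-1\<close>. Continuity is asked of the
  product \<open>v * (1 - v)\<close> with \<open>f'\<close>, so that \<open>f'\<close> itself may
  blow up at an endpoint, as happens for a power of \<open>v\<close> at
  \<open>v = 0\<close>.\<close>

lemma trapezoid_error_has_integral:
  fixes F f f' f'' :: "real \<Rightarrow> 'a::banach"
  assumes "continuous_on {0..1} F" "continuous_on {0..1} f"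
    and "continuous_on {0..1} (\<lambda>v. (v * (1 - v)) *\<^sub>R f' v)"
    and F: "\<And>v. v \<in> {0<..<1} \<Longrightarrow> (F has_vector_derivative f v) (at v)"
    and f: "\<And>v. v \<in> {0<..<1} \<Longrightarrow> (f has_vector_derivative f' v) (at v)"
    and f': "\<And>v. v \<in> {0<..<1} \<Longrightarrow> (f' has_vector_derivative f'' v) (at v)"
  shows "((\<lambda>v. (v * (1 - v) / 2) *\<^sub>R f'' v) has_integral
           ((1 / 2) *\<^sub>R (f 0 + f 1) - (F 1 - F 0))) {0..1}"
proof -
  define H where "H v = (1/2) *\<^sub>R ((v * (1 - v)) *\<^sub>R f' v) - (1/2 - v) *\<^sub>R f v - F v" for v
  have "((\<lambda>v. (v * (1 - v) / 2) *\<^sub>R f'' v) has_integral (H 1 - H 0)) {0..1}"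
  proof (rule fundamental_theorem_of_calculus_interior)
    show "continuous_on {0..1} H"
      unfolding H_def by (intro continuous_intros assms)
    fix v :: real assume v: "v \<in> {0<..<1}"
    show "(H has_vector_derivative (v * (1 - v) / 2) *\<^sub>R f'' v) (at v)"
    proof -
      have "((\<lambda>v. (v * (1 - v)) *\<^sub>R f' v) has_vector_derivative
              (v * (1 - v)) *\<^sub>R f'' v + (1 - 2 * v) *\<^sub>R f' v) (at v)"
        by (rule has_vector_derivative_scaleR[OF _ f'[OF v]]) (auto intro!: derivative_eq_intros)
      moreover have "((\<lambda>v. (1/2 - v) *\<^sub>R f v) has_vector_derivative
              (1/2 - v) *\<^sub>R f' v + (-1) *\<^sub>R f v) (at v)"
        by (rule has_vector_derivative_scaleR[OF _ f[OF v]]) (auto intro!: derivative_eq_intros)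
      ultimately have "(H has_vector_derivative
          (1/2) *\<^sub>R ((v * (1 - v)) *\<^sub>R f'' v + (1 - 2 * v) *\<^sub>R f' v)
          - ((1/2 - v) *\<^sub>R f' v + (-1) *\<^sub>R f v) - f v) (at v)"
        unfolding H_def
        by (intro has_vector_derivative_diff F[OF v]
            bounded_linear.has_vector_derivative[OF bounded_linear_scaleR_right])
      also have "(1/2) *\<^sub>R ((v * (1 - v)) *\<^sub>R f'' v + (1 - 2 * v) *\<^sub>R f' v)
          - ((1/2 - v) *\<^sub>R f' v + (-1) *\<^sub>R f v) - f v = (v * (1 - v) / 2) *\<^sub>R f'' v"
        by (simp add: scaleR_right_distrib scaleR_left_diff_distrib scaleR_right_diff_distrib)
      finally show ?thesis .
    qed
  qed simp
  moreover have "H 1 - H 0 = (1 / 2) *\<^sub>R (f 0 + f 1) - (F 1 - F 0)"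
    by (simp add: H_def scaleR_right_distrib)
  ultimately show ?thesis by simp
qed

text \<open>The kernel \<open>v * (1 - v) / 2\<close> has maximum \<open>1 / 8\<close>, attained at
  \<open>v = 1 / 2\<close>, and the interval has length 1.\<close>

lemma norm_trapezoid_error_le:
  fixes F f f' f'' :: "complex \<Rightarrow> complex"
  assumes F: "\<And>v. v \<in> {0..1} \<Longrightarrow> (F has_field_derivative f (of_real v)) (at (of_real v))"
    and f: "\<And>v. v \<in> {0..1} \<Longrightarrow> (f has_field_derivative f' (of_real v)) (at (of_real v))"
    and f': "\<And>v. v \<in> {0..1} \<Longrightarrow> (f' has_field_derivative f'' (of_real v)) (at (of_real v))"
    and B: "\<And>v. v \<in> {0..1} \<Longrightarrow> norm (f'' (of_real v)) \<le> B"
  shows "norm ((f 0 + f 1) / 2 - (F 1 - F 0)) \<le> B / 8"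
proof -
  have cont: "continuous_on {0..1::real} (\<lambda>v. g (of_real v))"
    if "\<And>v. v \<in> {0..1::real} \<Longrightarrow> (g has_field_derivative g' (of_real v)) (at (of_real v))"
    for g g' :: "complex \<Rightarrow> complex"
  proof (intro continuous_at_imp_continuous_on ballI)
    fix v :: real assume v: "v \<in> {0..1}"
    have "isCont g (of_real v)" using that[OF v] DERIV_isCont by blast
    thus "isCont (\<lambda>v. g (of_real v)) v" by (intro isCont_o2[where f = of_real and g = g]) auto
  qed
  have *: "((\<lambda>v. (v * (1 - v) / 2) *\<^sub>R f'' (of_real v)) has_integral
           ((1 / 2) *\<^sub>R (f (of_real 0) + f (of_real 1)) - (F (of_real 1) - F (of_real 0)))) (cbox 0 1)"
    unfolding cbox_interval
  proof (rule trapezoid_error_has_integral)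
    show "continuous_on {0..1} (\<lambda>v. (v * (1 - v)) *\<^sub>R f' (of_real v))"
      by (intro continuous_intros cont[OF f'])
    fix v :: real assume "v \<in> {0<..<1}"
    hence v: "v \<in> {0..1}" by simp
    show "((\<lambda>v. F (of_real v)) has_vector_derivative f (of_real v)) (at v)"
      by (rule has_vector_derivative_real_field[OF F[OF v]])
    show "((\<lambda>v. f (of_real v)) has_vector_derivative f' (of_real v)) (at v)"
      by (rule has_vector_derivative_real_field[OF f[OF v]])
    show "((\<lambda>v. f' (of_real v)) has_vector_derivative f'' (of_real v)) (at v)"
      by (rule has_vector_derivative_real_field[OF f'[OF v]])
  qed (use cont[OF F] cont[OF f] in blast)+
  have bound: "norm ((v * (1 - v) / 2) *\<^sub>R f'' (of_real v)) \<le> B / 8" if "v \<in> cbox 0 (1::real)" for v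
  proof -
    have "0 \<le> (v - 1/2)\<^sup>2" by simp
    hence "v * (1 - v) / 2 \<le> 1 / 8" by (simp add: power2_eq_square field_simps)
    moreover have "0 \<le> v * (1 - v) / 2" using that by simp
    moreover have "norm (f'' (of_real v)) \<le> B" using B that by simp
    ultimately have "v * (1 - v) / 2 * norm (f'' (of_real v)) \<le> 1 / 8 * B"
      by (intro mult_mono) auto
    thus ?thesis using \<open>0 \<le> v * (1 - v) / 2\<close> by simp
  qed
  have "0 \<le> B / 8" using order_trans[OF norm_ge_zero B[of 0]] by simp
  hence "norm ((1 / 2) *\<^sub>R (f (of_real 0) + f (of_real 1)) - (F (of_real 1) - F (of_real 0)))
      \<le> B / 8 * measure lborel (cbox 0 (1::real))"
    by (rule has_integral_bound[OF _ * bound])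
  thus ?thesis by (simp add: scaleR_conv_of_real)
qed

text \<open>
  The trapezoidal error for \<open>u\<^sup>-\<^sup>s\<close> on \<open>[n, n + 1]\<close>. At \<open>n = 0\<close> the convention \<open>0 powr z = 0\<close> gives
  \<open>1/2 - 1/(1 - s)\<close> for every \<open>s\<close>, which is the Euler-Maclaurin term needed to continue \<open>\<zeta>\<close>.
\<close>
definition zeta_term :: "nat \<Rightarrow> complex \<Rightarrow> complex" where
  "zeta_term n s = (of_nat n powr (-s) + of_nat (Suc n) powr (-s)) / 2
     - (of_nat (Suc n) powr (1 - s) - of_nat n powr (1 - s)) / (1 - s)"

text \<open>The second derivative of \<open>u powr (-s)\<close> is s (s + 1)
  \<open>u powr (-s - 2)\<close>, and for Re s \<ge> -2 its modulus on [n, n + 1] is largest at the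
  left end. The resulting exponent of \<open>n\<close> is below -1 precisely for Re s > -1, which
  determines the half-plane of convergence.\<close>

lemma norm_zeta_term_le:
  assumes "n > 0" "Re s \<ge> -2" "s \<noteq> 1"
  shows "norm (zeta_term n s) \<le> norm (s * (s + 1)) * real n powr (- Re s - 2) / 8"
proof -
  let ?f = "\<lambda>z. (of_nat n + z) powr (-s)"
  let ?F = "\<lambda>z. (of_nat n + z) powr (1 - s) / (1 - s)"
  have nz: "of_nat n + complex_of_real v \<notin> \<real>\<^sub>\<le>\<^sub>0" if "v \<in> {0..1}" for v
    using that assms by (auto simp: complex_nonpos_Reals_iff)
  have "norm ((?f 0 + ?f 1) / 2 - (?F 1 - ?F 0)) \<le> norm (s * (s + 1)) * real n powr (- Re s - 2) / 8"
  proof (rule norm_trapezoid_error_le[where f' = "\<lambda>z. -s * (of_nat n + z) powr (-s - 1)"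
        and f'' = "\<lambda>z. s * (s + 1) * (of_nat n + z) powr (-s - 2)"])
    fix v :: real assume v: "v \<in> {0..1}"
    show "(?F has_field_derivative ?f (of_real v)) (at (of_real v))"
      using nz[OF v] assms(3) by (auto intro!: derivative_eq_intros)
    show "(?f has_field_derivative -s * (of_nat n + of_real v) powr (-s - 1)) (at (of_real v))"
      using nz[OF v] by (auto intro!: derivative_eq_intros)
    show "((\<lambda>z. -s * (of_nat n + z) powr (-s - 1)) has_field_derivative
            s * (s + 1) * (of_nat n + of_real v) powr (-s - 2)) (at (of_real v))"
      using nz[OF v] by (auto intro!: derivative_eq_intros simp: algebra_simps)
    have "of_nat n + complex_of_real v = of_real (real n + v)" by simp
    hence "norm ((of_nat n + complex_of_real v) powr (-s - 2)) = (real n + v) powr (- Re s - 2)"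
      using v by (simp only:) (subst norm_powr_real_powr, auto)
    also have "\<dots> \<le> real n powr (- Re s - 2)"
      using v assms by (intro powr_mono2') auto
    finally show "norm (s * (s + 1) * (of_nat n + of_real v) powr (-s - 2))
        \<le> norm (s * (s + 1)) * real n powr (- Re s - 2)"
      by (simp add: norm_mult mult_left_mono)
  qed
  thus ?thesis by (simp add: zeta_term_def add_ac diff_divide_distrib)
qed

lemma zeta_term_0: "zeta_term 0 s = 1 / 2 - 1 / (1 - s)"
  by (simp add: zeta_term_def)

text \<open>The integrals telescope. Each of the nodes 1, ..., N collects two halves, the node 0
  contributes nothing, and the last node N + 1 keeps a single half.\<close>

lemma sum_zeta_term:
  assumes "s \<noteq> 1"
  shows "(\<Sum>n\<le>N. zeta_term n s) =
    (\<Sum>n<N. 1 / of_nat (Suc n) powr s) + of_nat (Suc N) powr (-s) / 2 - of_nat (Suc N) powr (1 - s) / (1 - s)"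
proof (induction N)
  case 0
  thus ?case by (simp add: zeta_term_0)
next
  case (Suc N)
  have "1 / of_nat (Suc N) powr s = (of_nat (Suc N) :: complex) powr (-s)" by (simp add: powr_minus_divide)
  thus ?case unfolding sum.atMost_Suc sum.lessThan_Suc Suc
    by (simp add: zeta_term_def diff_divide_distrib add_divide_distrib)
qed

lemma norm_nat_powr: "norm ((of_nat n :: complex) powr a) = real n powr Re a"
  using norm_powr_real_powr[of "of_nat n" a] by simp

lemma powr_neg_tendsto_0:
  assumes "Re a < 0"
  shows "(\<lambda>n. of_nat (Suc n) powr a) \<longlonglongrightarrow> (0 :: complex)"
proof (rule tendsto_norm_zero_cancel)
  have "(\<lambda>n. real (Suc n) powr Re a) \<longlonglongrightarrow> 0"
    using assms by (intro tendsto_neg_powr filterlim_compose[OF filterlim_real_sequentially filterlim_Suc])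
  moreover have "norm ((of_nat (Suc n) :: complex) powr a) = real (Suc n) powr Re a" for n
    by (rule norm_nat_powr)
  ultimately show "(\<lambda>n. norm ((of_nat (Suc n) :: complex) powr a)) \<longlonglongrightarrow> 0" by simp
qed

text \<open>For Re s > 1 both boundary terms at N + 1 in \<open>sum_zeta_term\<close> tend to 0, so
  the two sequences of partial sums have the same limits.\<close>

lemma zeta_term_sums_iff:
  assumes "Re s > 1"
  shows "(\<lambda>n. zeta_term n s) sums z \<longleftrightarrow> (\<lambda>n. 1 / of_nat (Suc n) powr s) sums z"
proof -
  have s: "s \<noteq> 1" using assms by auto
  have "(\<lambda>N. (\<Sum>n<N. 1 / of_nat (Suc n) powr s) - (\<Sum>n\<le>N. zeta_term n s)) =
        (\<lambda>N. of_nat (Suc N) powr (1 - s) / (1 - s) - of_nat (Suc N) powr (-s) / 2)"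
    unfolding sum_zeta_term[OF s] by (simp add: fun_eq_iff)
  moreover have "(\<lambda>N. of_nat (Suc N) powr (1 - s) / (1 - s) - of_nat (Suc N) powr (-s) / 2) \<longlonglongrightarrow> 0 / (1 - s) - 0 / 2"
    using assms s by (intro tendsto_intros powr_neg_tendsto_0) auto
  ultimately have *: "(\<lambda>N. (\<Sum>n<N. 1 / of_nat (Suc n) powr s) - (\<Sum>n\<le>N. zeta_term n s)) \<longlonglongrightarrow> 0" by simp
  \<comment> \<open>The trapezoidal partial sums run over n \<le> N and the Dirichlet ones over n <
    N, hence the two forms of the definition of \<open>sums\<close>.\<close>
  show ?thesis unfolding sums_def sums_def_le using Lim_transform_eq[OF *] sums_def_le[of "\<lambda>n. zeta_term n s" z] sums_def[of "\<lambda>n. zeta_term n s" z] by blast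
qed

section \<open>Holomorphy of the Dirichlet series and of the trapezoidal series\<close>

definition dirichlet_sum :: "complex \<Rightarrow> complex" where
  "dirichlet_sum s = (\<Sum>n. 1 / of_nat (Suc n) powr s)"

definition trapezoid_sum :: "complex \<Rightarrow> complex" where
  "trapezoid_sum s = (\<Sum>n. zeta_term n s)"

text \<open>The Weierstrass M-test with a majorant that may depend on the point. Local majorants are
  essential here, since both series converge only locally uniformly up to the boundary lines Re s =
  1 and Re s = -1.\<close>

lemma holomorphic_suminf:
  fixes f :: "nat \<Rightarrow> complex \<Rightarrow> complex"
  assumes S: "open S" and f: "\<And>n. f n holomorphic_on S"
    and *: "\<And>x. x \<in> S \<Longrightarrow> \<exists>d h. 0 < d \<and> summable h \<and> (\<forall>\<^sub>F n in sequentially. \<forall>y\<in>ball x d \<inter> S. norm (f n y) \<le> (h n :: real))"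
  shows "(\<lambda>z. \<Sum>n. f n z) holomorphic_on S" "\<And>z. z \<in> S \<Longrightarrow> (\<lambda>n. f n z) sums (\<Sum>n. f n z)"
proof -
  obtain g where g: "\<forall>x\<in>S. ((\<lambda>n. f n x) sums g x) \<and> g field_differentiable (at x)"
  proof (rule series_differentiable_comparison_complex[OF S])
    show "f n field_differentiable at x" if "x \<in> S" for n x
      using f S that holomorphic_on_imp_differentiable_at by blast
    fix x assume "x \<in> S"
    \<comment> \<open>The comparison test takes a majorant with values in the nonnegative reals for
      every index, whereas \<open>h\<close> is nonnegative only eventually. Its absolute value is
      therefore used, which changes finitely many terms.\<close>
    then obtain d and h :: "nat \<Rightarrow> real" where dh: "0 < d" "summable h"
      "\<forall>\<^sub>F n in sequentially. \<forall>y\<in>ball x d \<inter> S. norm (f n y) \<le> h n" using * by blast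
    have "\<forall>\<^sub>F n in sequentially. \<forall>y\<in>ball x d \<inter> S. norm (f n y) \<le> norm (complex_of_real \<bar>h n\<bar>)"
      using dh(3) by eventually_elim force
    moreover have "summable (\<lambda>n. complex_of_real \<bar>h n\<bar>)"
    proof -
      have "\<forall>\<^sub>F n in sequentially. norm \<bar>h n\<bar> \<le> h n"
        using dh(3)
      proof eventually_elim
        case (elim n)
        hence "norm (f n x) \<le> h n" using \<open>x \<in> S\<close> dh(1) by auto
        hence "0 \<le> h n" using norm_ge_zero order_trans by blast
        thus ?case by simp
      qed
      hence "summable (\<lambda>n. \<bar>h n\<bar>)" using dh(2) by (rule summable_comparison_test_ev)
      thus ?thesis by simp
    qed
    moreover have "range (\<lambda>n. complex_of_real \<bar>h n\<bar>) \<subseteq> \<real>\<^sub>\<ge>\<^sub>0" by auto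
    ultimately show "\<exists>d h. 0 < d \<and> summable h \<and> range h \<subseteq> \<real>\<^sub>\<ge>\<^sub>0 \<and> (\<forall>\<^sub>F n in sequentially. \<forall>y\<in>ball x d \<inter> S. cmod (f n y) \<le> cmod (h n))"
      using dh(1) by blast
  qed blast
  hence eq: "(\<Sum>n. f n z) = g z" if "z \<in> S" for z using that sums_unique by fastforce
  have "g holomorphic_on S"
    using g by (auto simp: holomorphic_on_def intro: field_differentiable_at_within)
  thus "(\<lambda>z. \<Sum>n. f n z) holomorphic_on S" using eq by (simp cong: holomorphic_cong)
  show "(\<lambda>n. f n z) sums (\<Sum>n. f n z)" if "z \<in> S" for z using g eq that by simp
qed

lemma summable_nat_powr: "a < -1 \<Longrightarrow> summable (\<lambda>n. real n powr a)"
  by (simp add: summable_real_powr_iff)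

lemma dirichlet_sum:
  shows holomorphic_dirichlet_sum: "dirichlet_sum holomorphic_on {s. Re s > 1}"
    and sums_dirichlet_sum: "\<And>s. Re s > 1 \<Longrightarrow> (\<lambda>n. 1 / of_nat (Suc n) powr s) sums dirichlet_sum s"
proof -
  have 1: "open {s. Re s > 1}" by (simp add: open_halfspace_Re_gt)
  have 2: "(\<lambda>s. 1 / of_nat (Suc n) powr s) holomorphic_on {s. Re s > 1}" for n
    by (intro holomorphic_intros) (auto simp del: of_nat_Suc)
  have 3: "\<exists>d h. 0 < d \<and> summable h \<and> (\<forall>\<^sub>F n in sequentially. \<forall>y\<in>ball x d \<inter> {s. Re s > 1}.
      norm (1 / of_nat (Suc n) powr y) \<le> (h n :: real))" if x: "x \<in> {s. Re s > 1}" for x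
  proof -
    \<comment> \<open>Half the distance to the line Re s = 1, so that Re y \<ge> 1 + d throughout
      the ball.\<close>
    define d where "d = (Re x - 1) / 2"
    have d: "d > 0" using x by (simp add: d_def)
    have "summable (\<lambda>n. real (Suc n) powr (-1 - d))"
      using d summable_Suc_iff[of "\<lambda>n. real n powr (-1 - d)"] summable_nat_powr[of "-1-d"] by simp
    moreover have "norm (1 / of_nat (Suc n) powr y) \<le> real (Suc n) powr (-1 - d)" if y: "y \<in> ball x d" for n y
    proof -
      have "Re x - Re y \<le> norm (x - y)" using abs_Re_le_cmod[of "x - y"] by simp
      hence "Re y \<ge> 1 + d" using y by (simp add: d_def dist_norm field_simps)
      moreover have "norm ((of_nat (Suc n) :: complex) powr y) = real (Suc n) powr Re y"
        by (rule norm_nat_powr)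
      moreover have "real (Suc n) powr (1 + d) \<le> real (Suc n) powr Re y"
        using \<open>Re y \<ge> 1 + d\<close> by (intro powr_mono) auto
      moreover have "real (Suc n) powr (-1 - d) = 1 / real (Suc n) powr (1 + d)"
        by (simp add: powr_minus_divide[symmetric])
      ultimately show ?thesis by (simp add: norm_divide frac_le del: of_nat_Suc)
    qed
    hence "\<forall>\<^sub>F n in sequentially. \<forall>y\<in>ball x d \<inter> {s. Re s > 1}.
        norm (1 / of_nat (Suc n) powr y) \<le> real (Suc n) powr (-1 - d)"
      by (intro always_eventually allI ballI) blast
    ultimately show ?thesis using d by blast
  qed
  show "dirichlet_sum holomorphic_on {s. Re s > 1}"
    unfolding dirichlet_sum_def[abs_def] by (rule holomorphic_suminf(1)[OF 1 2 3])
  show "(\<lambda>n. 1 / of_nat (Suc n) powr s) sums dirichlet_sum s" if "Re s > 1" for s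
    unfolding dirichlet_sum_def using that by (intro holomorphic_suminf(2)[OF 1 2 3]) auto
qed

lemma trapezoid_sum:
  shows holomorphic_trapezoid_sum: "trapezoid_sum holomorphic_on ({s. Re s > -1} - {1})"
    and sums_trapezoid_sum: "\<And>s. Re s > -1 \<Longrightarrow> s \<noteq> 1 \<Longrightarrow> (\<lambda>n. zeta_term n s) sums trapezoid_sum s"
proof -
  let ?S = "{s. Re s > -1} - {1}"
  have 1: "open ?S" by (intro open_Diff open_halfspace_Re_gt) auto
  have 2: "zeta_term n holomorphic_on ?S" for n
  proof (cases "n = 0")
    case True
    thus ?thesis unfolding zeta_term_0[abs_def] True by (intro holomorphic_intros) auto
  next
    case False
    thus ?thesis unfolding zeta_term_def[abs_def] by (intro holomorphic_intros) (auto simp del: of_nat_Suc)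
  qed
  have 3: "\<exists>d h. 0 < d \<and> summable h \<and> (\<forall>\<^sub>F n in sequentially. \<forall>y\<in>ball x d \<inter> ?S.
      norm (zeta_term n y) \<le> (h n :: real))" if x: "x \<in> ?S" for x
  proof -
    \<comment> \<open>Half the distance to the line Re s = -1, so that Re y \<ge> -1 + d throughout
      the ball; \<open>C\<close> bounds the factor \<open>norm (y * (y + 1)) / 8\<close>
      there.\<close>
    define d where "d = (Re x + 1) / 2"
    define C where "C = (norm x + d) * (norm x + d + 1) / 8"
    have d: "d > 0" using x by (simp add: d_def)
    have "summable (\<lambda>n. C * real n powr (-1 - d))"
      using d by (intro summable_mult summable_nat_powr) auto
    moreover have "norm (zeta_term n y) \<le> C * real n powr (-1 - d)"
      if y: "y \<in> ball x d \<inter> ?S" and n: "n > 0" for n y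
    proof -
      have "Re x - Re y \<le> norm (x - y)" using abs_Re_le_cmod[of "x - y"] by simp
      hence *: "Re y \<ge> -1 + d" using y by (simp add: d_def dist_norm field_simps)
      have ny: "norm y \<le> norm x + d"
        using y norm_triangle_ineq2[of y x] by (auto simp: dist_norm norm_minus_commute)
      have "norm (zeta_term n y) \<le> norm (y * (y + 1)) * real n powr (- Re y - 2) / 8"
        using y n by (intro norm_zeta_term_le) auto
      also have "\<dots> \<le> ((norm x + d) * (norm x + d + 1)) * real n powr (-1 - d) / 8"
        unfolding norm_mult using ny * n norm_triangle_ineq[of y 1] d
        by (intro divide_right_mono mult_mono powr_mono) auto
      finally show ?thesis by (simp add: C_def)
    qed
    hence "\<forall>\<^sub>F n in sequentially. \<forall>y\<in>ball x d \<inter> ?S. norm (zeta_term n y) \<le> C * real n powr (-1 - d)"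
      by (intro eventually_mono[OF eventually_gt_at_top[of 0]] ballI) blast
    ultimately show ?thesis using d by blast
  qed
  show "trapezoid_sum holomorphic_on ?S"
    unfolding trapezoid_sum_def[abs_def] by (rule holomorphic_suminf(1)[OF 1 2 3])
  show "(\<lambda>n. zeta_term n s) sums trapezoid_sum s" if "Re s > -1" "s \<noteq> 1" for s
    unfolding trapezoid_sum_def using that by (intro holomorphic_suminf(2)[OF 1 2 3]) auto
qed

lemma trapezoid_sum_eq_dirichlet_sum:
  assumes "Re s > 1"
  shows "trapezoid_sum s = dirichlet_sum s"
proof -
  have "(\<lambda>n. zeta_term n s) sums trapezoid_sum s"
    using assms by (intro sums_trapezoid_sum) auto
  moreover have "(\<lambda>n. zeta_term n s) sums dirichlet_sum s"
    using assms sums_dirichlet_sum zeta_term_sums_iff by blast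
  ultimately show ?thesis by (rule sums_unique2)
qed

subsection \<open>Partial fractions of the hyperbolic cotangent\<close>

text \<open>Differentiate the reflection formula
  \<open>rGamma z * rGamma (1 - z) = sin (pi * z) / pi\<close> on both sides and divide by it;
  \<open>sin (pi * z)\<close> is nonzero off the integers.\<close>

lemma Digamma_reflection:
  fixes z :: complex
  assumes "z \<notin> \<int>"
  shows "Digamma (1 - z) - Digamma z = of_real pi * cot (of_real pi * z)"
proof -
  have nz: "z \<notin> \<int>\<^sub>\<le>\<^sub>0" "1 - z \<notin> \<int>\<^sub>\<le>\<^sub>0"
    using assms Ints_diff[of 1 "1 - z"] nonpos_Ints_subset_Ints by auto
  have s: "sin (of_real pi * z) \<noteq> 0"
    using assms by (auto simp: sin_eq_0 mult.commute)
  have "((\<lambda>z. rGamma z * rGamma (1 - z)) has_field_derivative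
          (- rGamma z * Digamma z) * rGamma (1 - z) + rGamma z * (rGamma (1 - z) * Digamma (1 - z))) (at z)"
    using nz by (auto intro!: derivative_eq_intros simp: algebra_simps)
  moreover have "((\<lambda>z. rGamma z * rGamma (1 - z)) has_field_derivative cos (of_real pi * z)) (at z)"
    unfolding rGamma_reflection_complex by (auto intro!: derivative_eq_intros)
  ultimately have "(- rGamma z * Digamma z) * rGamma (1 - z) + rGamma z * (rGamma (1 - z) * Digamma (1 - z)) = cos (of_real pi * z)"
    by (rule DERIV_unique)
  hence "(rGamma z * rGamma (1 - z)) * (Digamma (1 - z) - Digamma z) = cos (of_real pi * z)"
    by (simp add: algebra_simps)
  thus ?thesis unfolding rGamma_reflection_complex using s
    by (simp add: cot_def field_simps)
qed

text \<open>Subtract the limit formulas for \<open>Digamma\<close> at 1 - z and at z. The logarithms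
  cancel, and the remaining reciprocals of z + k and z - k combine in pairs.\<close>

lemma cot_partial_fractions:
  fixes z :: complex
  assumes "z \<notin> \<int>"
  shows "(\<lambda>k. 2 * z / (z\<^sup>2 - of_nat (Suc k) ^ 2)) sums (of_real pi * cot (of_real pi * z) - 1 / z)"
proof -
  have nz: "z \<noteq> 0" "1 - z \<noteq> 0" using assms by auto
  have nk: "z \<noteq> of_nat k" "z \<noteq> - of_nat k" for k using assms by auto
  have "(\<lambda>m. (of_real (ln (real m)) - (\<Sum>n<m. inverse (1 - z + of_nat n))) -
             (of_real (ln (real m)) - (\<Sum>n<m. inverse (z + of_nat n)))) \<longlonglongrightarrow> Digamma (1 - z) - Digamma z"
    by (intro tendsto_diff Digamma_LIMSEQ nz)
  hence "(\<lambda>m. (\<Sum>n<Suc m. inverse (z + of_nat n)) - (\<Sum>n<Suc m. inverse (1 - z + of_nat n)))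
            \<longlonglongrightarrow> of_real pi * cot (of_real pi * z)"
    unfolding Digamma_reflection[OF assms]
    by (subst (asm) filterlim_sequentially_Suc[symmetric]) (simp del: sum.lessThan_Suc)
  \<comment> \<open>The first sum runs over z, ..., z + m and the second over z - 1, ..., z - (m +
    1) up to sign. Pairing k = 1, ..., m leaves \<open>1 / z\<close> and the last reciprocal, which
    tends to 0.\<close>
  also have "(\<lambda>m. (\<Sum>n<Suc m. inverse (z + of_nat n)) - (\<Sum>n<Suc m. inverse (1 - z + of_nat n))) =
      (\<lambda>m. 1 / z + (\<Sum>k<m. 2 * z / (z\<^sup>2 - of_nat (Suc k) ^ 2)) + inverse (z - of_nat (Suc m)))"
  proof
    fix m
    have "inverse (z + of_nat (Suc k)) + inverse (z - of_nat (Suc k)) = 2 * z / (z\<^sup>2 - of_nat (Suc k) ^ 2)" for k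
    proof -
      have "inverse (z + c) + inverse (z - c) = 2 * z / (z\<^sup>2 - c ^ 2)" if "z + c \<noteq> 0" "z - c \<noteq> 0" for c
        using that by (simp add: power2_eq_square square_diff_square_factored add_frac_eq inverse_eq_divide)
      thus ?thesis using nk[of "Suc k"] by (simp only: eq_neg_iff_add_eq_0 right_minus_eq) blast
    qed
    hence *: "(\<Sum>k<m. inverse (z + of_nat (Suc k))) + (\<Sum>k<m. inverse (z - of_nat (Suc k))) =
        (\<Sum>k<m. 2 * z / (z\<^sup>2 - of_nat (Suc k) ^ 2))" by (simp del: of_nat_Suc flip: sum.distrib)
    have "inverse (1 - z + of_nat n) = - inverse (z - of_nat (Suc n))" for n
      by (metis add.commute diff_add_eq inverse_minus_eq minus_diff_eq of_nat_Suc)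
    hence "(\<Sum>n<Suc m. inverse (1 - z + of_nat n)) = - (\<Sum>n<Suc m. inverse (z - of_nat (Suc n)))"
      by (simp add: sum_negf del: of_nat_Suc sum.lessThan_Suc)
    moreover have "(\<Sum>n<Suc m. inverse (z + of_nat n)) = 1 / z + (\<Sum>k<m. inverse (z + of_nat (Suc k)))"
      by (subst sum.lessThan_Suc_shift) (simp add: inverse_eq_divide)
    ultimately show "(\<Sum>n<Suc m. inverse (z + of_nat n)) - (\<Sum>n<Suc m. inverse (1 - z + of_nat n)) =
       1 / z + (\<Sum>k<m. 2 * z / (z\<^sup>2 - of_nat (Suc k) ^ 2)) + inverse (z - of_nat (Suc m))"
      using * by (simp del: of_nat_Suc)
  qed
  finally have "(\<lambda>m. 1 / z + (\<Sum>k<m. 2 * z / (z\<^sup>2 - of_nat (Suc k) ^ 2)) + inverse (z - of_nat (Suc m)))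
      \<longlonglongrightarrow> of_real pi * cot (of_real pi * z)" .
  moreover have "(\<lambda>m. inverse (z - of_nat (Suc m))) \<longlonglongrightarrow> 0"
  proof -
    have "filterlim (\<lambda>m. of_nat (Suc m) - z) at_infinity sequentially"
      unfolding diff_conv_add_uminus
      by (rule tendsto_add_filterlim_at_infinity'[OF _ tendsto_const])
         (intro filterlim_compose[OF tendsto_of_nat filterlim_Suc])
    hence "(\<lambda>m. - inverse (of_nat (Suc m) - z)) \<longlonglongrightarrow> - 0"
      by (intro tendsto_minus filterlim_compose[OF tendsto_inverse_0])
    moreover have "- inverse (of_nat (Suc m) - z) = inverse (z - of_nat (Suc m))" for m
      by (metis inverse_minus_eq minus_diff_eq)
    ultimately show ?thesis by simp
  qed
  ultimately have "(\<lambda>m. (1 / z + (\<Sum>k<m. 2 * z / (z\<^sup>2 - of_nat (Suc k) ^ 2)) + inverse (z - of_nat (Suc m)))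
      - inverse (z - of_nat (Suc m)) - 1 / z) \<longlonglongrightarrow> of_real pi * cot (of_real pi * z) - 0 - 1 / z"
    by (intro tendsto_diff tendsto_const)
  thus ?thesis by (simp add: sums_def)
qed

text \<open>The cotangent expansion on the imaginary axis, where the cotangent becomes a hyperbolic
  cotangent. All terms are positive for x > 0, which later justifies termwise integration.\<close>

lemma planck_partial_fractions:
  fixes x :: real
  assumes "x > 0"
  shows "(\<lambda>k. 2 * x / (x\<^sup>2 + (2 * pi * real (Suc k))\<^sup>2)) sums
           ((1 + exp (- x)) / (2 * (1 - exp (- x))) - 1 / x)"
proof -
  \<comment> \<open>Chosen so that pi z is x / 2 times the imaginary unit; the cotangent then yields
    coth(x/2), and z^2 - k^2 becomes a negative multiple of x^2 + (2 pi k)^2.\<close>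
  define z where "z = \<i> * of_real (x / (2 * pi))"
  have z: "z \<notin> \<int>"
  proof
    assume "z \<in> \<int>"
    hence "Im z = 0" by (auto elim!: Ints_cases)
    thus False using assms by (simp add: z_def)
  qed
  have z2: "z\<^sup>2 = of_real (- (x\<^sup>2 / (2 * pi)\<^sup>2))"
    by (simp add: z_def power_mult_distrib power_divide)
  have "2 * z / (z\<^sup>2 - of_nat (Suc k) ^ 2) = - \<i> * of_real (2 * pi * (2 * x / (x\<^sup>2 + (2 * pi * real (Suc k))\<^sup>2)))" for k
  proof -
    have "0 < x\<^sup>2 + (2 * pi * real (Suc k))\<^sup>2" using assms by (intro add_pos_nonneg) auto
    hence ne: "x\<^sup>2 + (2 * pi * real (Suc k))\<^sup>2 \<noteq> 0" by simp
    have "z\<^sup>2 - of_nat (Suc k) ^ 2 = of_real (- (x\<^sup>2 + (2 * pi * real (Suc k))\<^sup>2) / (2 * pi)\<^sup>2)"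
      by (simp add: z2 field_simps power_mult_distrib del: of_nat_Suc)
    hence "2 * z / (z\<^sup>2 - of_nat (Suc k) ^ 2) =
       \<i> * of_real (2 * (x / (2 * pi)) / (- (x\<^sup>2 + (2 * pi * real (Suc k))\<^sup>2) / (2 * pi)\<^sup>2))"
      unfolding z_def by (simp only: of_real_divide of_real_mult of_real_numeral) (simp add: mult_ac)
    also have "2 * (x / (2 * pi)) / (- (x\<^sup>2 + (2 * pi * real (Suc k))\<^sup>2) / (2 * pi)\<^sup>2) =
        - (2 * pi * (2 * x / (x\<^sup>2 + (2 * pi * real (Suc k))\<^sup>2)))"
    proof -
      have "2 * (x / c) / (- D / c\<^sup>2) = - (c * (2 * x / D))" if "D \<noteq> 0" "c \<noteq> 0" for c D :: real
        using that by (simp add: field_simps power2_eq_square)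
      thus ?thesis using ne pi_neq_zero by (metis mult_eq_0_iff zero_neq_numeral)
    qed
    finally show ?thesis by simp
  qed
  hence "(\<lambda>k. - \<i> * of_real (2 * pi * (2 * x / (x\<^sup>2 + (2 * pi * real (Suc k))\<^sup>2)))) sums
      (of_real pi * cot (of_real pi * z) - 1 / z)"
    using cot_partial_fractions[OF z] by simp
  also have "of_real pi * cot (of_real pi * z) - 1 / z =
      - \<i> * of_real (2 * pi * ((1 + exp (- x)) / (2 * (1 - exp (- x))) - 1 / x))"
  proof -
    have pz: "of_real pi * z = \<i> * of_real (x / 2)" by (simp add: z_def)
    define a where "a = exp (x / 2)"
    have a: "a > 1" using assms by (simp add: a_def)
    have e: "exp (-x) = 1 / a\<^sup>2"
      by (simp add: a_def exp_minus inverse_eq_divide flip: exp_of_nat_mult)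
    have c: "exp (\<i> * (\<i> * of_real (x / 2))) = of_real (1 / a)" "exp (- (\<i> * (\<i> * of_real (x / 2)))) = of_real a"
      by (simp_all add: a_def exp_minus inverse_eq_divide flip: mult.assoc exp_of_real)
    have "cos (of_real pi * z) = of_real ((1 / a + a) / 2)"
      unfolding pz cos_exp_eq c by simp
    moreover have "sin (of_real pi * z) = of_real ((1 / a - a) / 2) / \<i>"
      unfolding pz sin_exp_eq c by simp
    ultimately have "cot (of_real pi * z) = \<i> * of_real (((1 / a + a) / 2) / ((1 / a - a) / 2))"
      unfolding cot_def by (simp only: of_real_divide[of "(1 / a + a) / 2"]) (simp only: divide_divide_eq_right mult.commute times_divide_eq_right)
    also have "((1 / a + a) / 2) / ((1 / a - a) / 2) = - ((1 + exp (- x)) / (1 - exp (- x)))"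
      unfolding e using a by (auto simp add: divide_simps power2_eq_square) (auto simp: algebra_simps power2_eq_square)
    finally have "of_real pi * cot (of_real pi * z) = - \<i> * of_real (pi * ((1 + exp (- x)) / (1 - exp (- x))))"
      by simp
    moreover have "1 / z = - \<i> * of_real (2 * pi / x)"
      using assms by (simp add: z_def field_simps)
    moreover have "2 * pi * ((1 + exp (- x)) / (2 * (1 - exp (- x))) - 1 / x) =
       pi * ((1 + exp (- x)) / (1 - exp (- x))) - 2 * pi / x"
    proof -
      have "2 * pi * (a / (2 * b)) = pi * (a / b)" for a b :: real by simp
      from this[of "1 + exp (- x)" "1 - exp (- x)"] show ?thesis
        by (simp only: right_diff_distrib[of "2 * pi"] times_divide_eq_right mult_1_right)
    qed
    ultimately show ?thesis by (simp add: algebra_simps)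
  qed
  finally have "(\<lambda>k. \<i> / of_real (2 * pi) * (- \<i> * of_real (2 * pi * (2 * x / (x\<^sup>2 + (2 * pi * real (Suc k))\<^sup>2))))) sums
      (\<i> / of_real (2 * pi) * (- \<i> * of_real (2 * pi * ((1 + exp (- x)) / (2 * (1 - exp (- x))) - 1 / x))))"
    by (rule sums_mult)
  moreover have "\<i> / of_real (2 * pi) * (- \<i> * of_real (2 * pi * u)) = of_real u" for u
    by simp
  ultimately show ?thesis by (simp only: sums_of_real_iff)
qed

subsection \<open>Mellin transforms\<close>

definition zeta_term_real :: "nat \<Rightarrow> real \<Rightarrow> real" where
  "zeta_term_real n a = (real n powr (-a) + real (Suc n) powr (-a)) / 2
     - (real (Suc n) powr (1 - a) - real n powr (1 - a)) / (1 - a)"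

lemma zeta_term_of_real: "zeta_term n (of_real a) = of_real (zeta_term_real n a)"
proof -
  have "(of_nat m :: complex) powr of_real b = of_real (real m powr b)" for m b
    using powr_of_real[of "real m" b] by simp
  from this[of _ "-a"] this[of _ "1 - a"] show ?thesis
    by (simp add: zeta_term_def zeta_term_real_def del: of_nat_Suc)
qed

lemma nn_integral_has_integral_restrict:
  fixes f :: "real \<Rightarrow> real"
  assumes [measurable]: "f \<in> borel_measurable borel" "S \<in> sets borel"
    and "\<And>x. x \<in> S \<Longrightarrow> 0 \<le> f x" and "(f has_integral I) S"
  shows "(\<integral>\<^sup>+x. ennreal (indicator S x * f x) \<partial>lborel) = ennreal I"
proof (rule nn_integral_has_integral_lborel)
  show "(\<lambda>x. indicator S x * f x) \<in> borel_measurable borel" by measurable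
  show "0 \<le> indicator S x * f x" for x using assms(3)[of x] by (auto simp: indicator_def)
  have "((\<lambda>x. if x \<in> S then f x else 0) has_integral I) UNIV"
    using assms(4) by (simp only: has_integral_restrict_UNIV)
  thus "((\<lambda>x. indicator S x * f x) has_integral I) UNIV"
    by (rule has_integral_eq[rotated]) (auto simp: indicator_def)
qed

text \<open>The kernel identity for \<open>u powr (-a)\<close>, divided by the constant a (a + 1) of
  its second derivative. The integrand is nonnegative, so every \<open>zeta_term_real n a\<close>
  has the sign of a (a + 1).\<close>

lemma trapezoid_kernel_powr:
  assumes "-1 < a" "a < 0"
  shows "((\<lambda>v. v * (1 - v) / 2 * (real n + v) powr (- a - 2)) has_integral
           zeta_term_real n a / (a * (a + 1))) {0..1}"
proof -
  let ?F = "\<lambda>v. (real n + v) powr (1 - a) / (1 - a)"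
  let ?f = "\<lambda>v. (real n + v) powr (- a)"
  have "((\<lambda>v. (v * (1 - v) / 2) *\<^sub>R (a * (a + 1) * (real n + v) powr (- a - 2))) has_integral
           ((1 / 2) *\<^sub>R (?f 0 + ?f 1) - (?F 1 - ?F 0))) {0..1}"
  proof (rule trapezoid_error_has_integral)
    show "continuous_on {0..1} ?F" "continuous_on {0..1} ?f"
      using assms by (auto intro!: continuous_intros continuous_on_powr')
    \<comment> \<open>For n = 0 the power \<open>v powr (- a - 1)\<close> is unbounded at 0. The
      factor \<open>v\<close> of the kernel turns it into \<open>v powr (- a)\<close>, which is
      continuous because -a > 0.\<close>
    have "continuous_on {0..1} (\<lambda>v. (- a * (1 - v)) * (v * (real n + v) powr (- a - 1)))"
    proof (cases "n = 0")
      case True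
      have "continuous_on {0..1} (\<lambda>v. (- a * (1 - v)) * (v powr (- a)))"
        using assms by (auto intro!: continuous_intros continuous_on_powr')
      moreover have "v powr (- a) = v * (real n + v) powr (- a - 1)" if "v \<in> {0..1}" for v
        using that True by (cases "v = 0") (auto simp: powr_diff field_simps powr_minus)
      ultimately show ?thesis
        by (subst continuous_on_cong[OF refl, of _ _ "\<lambda>v. (- a * (1 - v)) * (v powr (- a))"]) auto
    next
      case False
      thus ?thesis by (auto intro!: continuous_intros continuous_on_powr')
    qed
    thus "continuous_on {0..1} (\<lambda>v. (v * (1 - v)) *\<^sub>R (- a * (real n + v) powr (- a - 1)))"
      by (simp add: mult_ac)
    fix v :: real assume "v \<in> {0<..<1}"
    hence v: "real n + v > 0" by (simp add: add_nonneg_pos)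
    show "(?F has_vector_derivative ?f v) (at v)"
      unfolding has_real_derivative_iff_has_vector_derivative[symmetric]
      using v assms by (auto intro!: derivative_eq_intros)
    show "(?f has_vector_derivative (- a * (real n + v) powr (- a - 1))) (at v)"
      unfolding has_real_derivative_iff_has_vector_derivative[symmetric]
      using v assms by (auto intro!: derivative_eq_intros)
    show "((\<lambda>v. - a * (real n + v) powr (- a - 1)) has_vector_derivative
        (a * (a + 1) * (real n + v) powr (- a - 2))) (at v)"
      unfolding has_real_derivative_iff_has_vector_derivative[symmetric]
      using v assms by (auto intro!: derivative_eq_intros simp: algebra_simps)
  qed
  hence "((\<lambda>v. (v * (1 - v) / 2) *\<^sub>R (a * (a + 1) * (real n + v) powr (- a - 2))) has_integral
           zeta_term_real n a) {0..1}"
    by (simp add: zeta_term_real_def diff_divide_distrib add.commute)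
  hence "((\<lambda>v. 1 / (a * (a + 1)) * ((v * (1 - v) / 2) *\<^sub>R (a * (a + 1) * (real n + v) powr (- a - 2)))) has_integral
           1 / (a * (a + 1)) * zeta_term_real n a) {0..1}"
    by (rule has_integral_mult_right)
  moreover have "1 / (a * (a + 1)) * ((v * (1 - v) / 2) *\<^sub>R (a * (a + 1) * (real n + v) powr (- a - 2))) =
      v * (1 - v) / 2 * (real n + v) powr (- a - 2)" for v
    using assms by simp
  ultimately show ?thesis by simp
qed

text \<open>The same kernel identity for an exponential. The value equals (1 -
  \<open>exp (- x)\<close>) times \<open>planck x\<close> divided by x^2, which is how
  \<open>planck\<close> arises from trapezoidal errors.\<close>

lemma trapezoid_kernel_exp:
  fixes x :: real
  assumes "x > 0"
  shows "((\<lambda>v. v * (1 - v) / 2 * exp (- v * x)) has_integral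
           ((1 + exp (- x)) / 2 - (1 - exp (- x)) / x) / x\<^sup>2) {0..1}"
proof -
  let ?F = "\<lambda>v. - exp (- v * x) / x ^ 3"
  let ?f = "\<lambda>v. exp (- v * x) / x\<^sup>2"
  have "((\<lambda>v. (v * (1 - v) / 2) *\<^sub>R exp (- v * x)) has_integral
           ((1 / 2) *\<^sub>R (?f 0 + ?f 1) - (?F 1 - ?F 0))) {0..1}"
  proof (rule trapezoid_error_has_integral[where f' = "\<lambda>v. - exp (- v * x) / x"])
    fix v :: real
    show "(?F has_vector_derivative ?f v) (at v)"
      unfolding has_real_derivative_iff_has_vector_derivative[symmetric]
      using assms by (auto intro!: derivative_eq_intros simp: power2_eq_square power3_eq_cube)
    show "(?f has_vector_derivative (- exp (- v * x) / x)) (at v)"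
      unfolding has_real_derivative_iff_has_vector_derivative[symmetric]
      using assms by (auto intro!: derivative_eq_intros simp: power2_eq_square)
    show "((\<lambda>v. - exp (- v * x) / x) has_vector_derivative exp (- v * x)) (at v)"
      unfolding has_real_derivative_iff_has_vector_derivative[symmetric]
      using assms by (auto intro!: derivative_eq_intros)
  qed (use assms in \<open>auto intro!: continuous_intros\<close>)
  also have "(1 / 2) *\<^sub>R (?f 0 + ?f 1) - (?F 1 - ?F 0) = ((1 + exp (- x)) / 2 - (1 - exp (- x)) / x) / x\<^sup>2"
    using assms by (simp add: field_simps power2_eq_square power3_eq_cube)
  finally show ?thesis by simp
qed

lemma nn_integral_Gamma_scaled:
  assumes "b > 0" "c > (0 :: real)"
  shows "(\<integral>\<^sup>+x. ennreal (indicator {0<..} x * (x powr (b - 1) * exp (- c * x))) \<partial>lborel)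
           = ennreal (Gamma b * c powr (- b))"
proof -
  have "ennreal (Gamma b) = (\<integral>\<^sup>+t. ennreal (indicator {0..} t * t powr (b - 1) / exp t) \<partial>lborel)"
    by (rule Gamma_conv_nn_integral_real) fact
  also have "\<dots> = ennreal \<bar>c\<bar> * (\<integral>\<^sup>+x. ennreal (indicator {0..} (0 + c * x) * (0 + c * x) powr (b - 1) / exp (0 + c * x)) \<partial>lborel)"
    by (rule nn_integral_real_affine) (use assms in auto)
  also have "(\<integral>\<^sup>+x. ennreal (indicator {0..} (0 + c * x) * (0 + c * x) powr (b - 1) / exp (0 + c * x)) \<partial>lborel)
    = (\<integral>\<^sup>+x. ennreal (c powr (b - 1)) * ennreal (indicator {0<..} x * (x powr (b - 1) * exp (- c * x))) \<partial>lborel)"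
  proof (intro nn_integral_cong)
    fix x :: real
    \<comment> \<open>The closed and the open half-line agree because at x = 0 the power
      \<open>0 powr (b - 1)\<close> is 0 by convention.\<close>
    show "ennreal (indicator {0..} (0 + c * x) * (0 + c * x) powr (b - 1) / exp (0 + c * x)) =
      ennreal (c powr (b - 1)) * ennreal (indicator {0<..} x * (x powr (b - 1) * exp (- c * x)))"
      using assms by (cases "x > 0"; cases "x = 0")
        (auto simp: indicator_def powr_mult exp_minus field_simps zero_le_mult_iff simp flip: ennreal_mult')
  qed
  also have "\<dots> = ennreal (c powr (b - 1)) * (\<integral>\<^sup>+x. ennreal (indicator {0<..} x * (x powr (b - 1) * exp (- c * x))) \<partial>lborel)"
    by (rule nn_integral_cmult) measurable
  finally have "ennreal (Gamma b) = ennreal (c powr b) * (\<integral>\<^sup>+x. ennreal (indicator {0<..} x * (x powr (b - 1) * exp (- c * x))) \<partial>lborel)"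
    using assms by (simp add: powr_diff mult.assoc[symmetric] flip: ennreal_mult')
  hence "ennreal (c powr (-b)) * ennreal (Gamma b) = ennreal (c powr (-b)) * ennreal (c powr b) * (\<integral>\<^sup>+x. ennreal (indicator {0<..} x * (x powr (b - 1) * exp (- c * x))) \<partial>lborel)"
    by (simp add: mult.assoc)
  also have "ennreal (c powr (-b)) * ennreal (c powr b) = 1"
    using assms by (simp flip: ennreal_mult' powr_add)
  finally show ?thesis using assms by (simp add: mult.commute flip: ennreal_mult')
qed

text \<open>Substitute \<open>t = u\<^sup>2 / (u\<^sup>2 + c\<^sup>2)\<close> in the Beta integral.\<close>
lemma nn_integral_Beta_scaled:
  assumes "-1 < a" "a < 1" "c > (0 :: real)"
  shows "(\<integral>\<^sup>+x. ennreal (indicator {0<..} x * (x powr (a - 1) * (2 * x / (x\<^sup>2 + c\<^sup>2)))) \<partial>lborel)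
           = ennreal (c powr (a - 1) * Beta ((1 + a) / 2) ((1 - a) / 2))"
proof -
  define p q where "p = (1 + a) / 2" and "q = (1 - a) / 2"
  define f where "f t = t powr (p - 1) * (1 - t) powr (q - 1)" for t :: real
  define g where "g u = u\<^sup>2 / (u\<^sup>2 + c\<^sup>2)" for u :: real
  define g' where "g' u = 2 * u * c\<^sup>2 / (u\<^sup>2 + c\<^sup>2)\<^sup>2" for u :: real
  have pq: "p > 0" "q > 0" using assms by (auto simp: p_def q_def)
  have D: "u\<^sup>2 + c\<^sup>2 > 0" for u using assms by (intro add_nonneg_pos) auto
  have D': "u\<^sup>2 + c\<^sup>2 \<noteq> 0" for u using less_imp_neq[OF D[of u]] by (rule not_sym)
  have img: "g ` {0<..} = {0<..<1}"
  proof (intro equalityI subsetI)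
    fix t assume "t \<in> g ` {0<..}"
    thus "t \<in> {0<..<1}" using D assms by (auto simp: g_def divide_simps add_pos_nonneg)
  next
    fix t :: real assume t: "t \<in> {0<..<1}"
    \<comment> \<open>The solution of t = u^2 / (u^2 + c^2) for positive u.\<close>
    define u where "u = c * sqrt (t / (1 - t))"
    have "u\<^sup>2 = c\<^sup>2 * (t / (1 - t))" using t by (simp add: u_def power_mult_distrib)
    hence "g u = t" using t assms by (simp add: g_def field_simps)
    moreover have "u > 0" using t assms by (simp add: u_def)
    ultimately show "t \<in> g ` {0<..}" by (intro image_eqI[of _ _ u]) auto
  qed
  have inj: "inj_on g {0<..}"
  proof (rule inj_onI)
    fix u v :: real assume uv: "u \<in> {0<..}" "v \<in> {0<..}" "g u = g v"
    hence "u\<^sup>2 * (v\<^sup>2 + c\<^sup>2) = v\<^sup>2 * (u\<^sup>2 + c\<^sup>2)" using D' by (simp add: g_def frac_eq_eq)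
    hence "u\<^sup>2 = v\<^sup>2" using assms by (simp add: algebra_simps)
    thus "u = v" using uv by (simp add: power2_eq_iff)
  qed
  have der: "(g has_field_derivative g' u) (at u within {0<..})" for u
    unfolding g_def g'_def using D'[of u]
    by (auto intro!: derivative_eq_intros simp: power2_eq_square algebra_simps)
  have "(f has_integral Beta p q) {0<..<1}"
    using has_integral_Beta_real[OF pq] unfolding f_def[abs_def] by (simp add: has_integral_Icc_iff_Ioo)
  moreover have "f absolutely_integrable_on {0<..<1}"
    using calculation by (intro nonnegative_absolutely_integrable_1) (auto simp: f_def has_integral_integrable)
  ultimately have "(\<lambda>u. \<bar>g' u\<bar> * f (g u)) absolutely_integrable_on {0<..} \<and>
      integral {0<..} (\<lambda>u. \<bar>g' u\<bar> * f (g u)) = Beta p q"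
    by (subst has_absolute_integral_change_of_variables_1'[OF _ der inj]) (auto simp: img integral_unique)
  hence "((\<lambda>u. \<bar>g' u\<bar> * f (g u)) has_integral Beta p q) {0<..}"
    using set_lebesgue_integral_eq_integral(1) has_integral_integrable_integral by blast
  hence "((\<lambda>u. c powr (a - 1) * (\<bar>g' u\<bar> * f (g u))) has_integral c powr (a - 1) * Beta p q) {0<..}"
    by (rule has_integral_mult_right)
  moreover have "c powr (a - 1) * (\<bar>g' u\<bar> * f (g u)) = u powr (a - 1) * (2 * u / (u\<^sup>2 + c\<^sup>2))" if "u \<in> {0<..}" for u
  proof -
    define E where "E = u\<^sup>2 + c\<^sup>2"
    have E: "E > 0" unfolding E_def by (rule D)
    have u: "u > 0" using that by simp
    have pe: "2 * (p - 1) = a - 1" "2 * (q - 1) = - a - 1"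
      by (simp_all add: p_def q_def field_simps)
    have sq: "(x\<^sup>2) powr r = x powr (2 * r)" if "x > 0" for x r :: real
      using that by (simp add: powr_powr flip: powr_numeral)
    have "1 - g u = (E - u\<^sup>2) / E" using E by (simp add: g_def diff_divide_distrib flip: E_def)
    also have "E - u\<^sup>2 = c\<^sup>2" by (simp add: E_def)
    finally have "1 - g u = c\<^sup>2 / E" .
    hence "f (g u) = (u\<^sup>2 / E) powr (p - 1) * (c\<^sup>2 / E) powr (q - 1)" by (simp add: f_def g_def E_def)
    also have "\<dots> = (u\<^sup>2) powr (p - 1) * (c\<^sup>2) powr (q - 1) / (E powr (p - 1) * E powr (q - 1))"
      using E by (simp add: powr_divide)
    \<comment> \<open>Here p + q = 1, so the two exponents add up to -1.\<close>
    also have "E powr (p - 1) * E powr (q - 1) = E powr (-1)"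
      by (simp add: p_def q_def field_simps flip: powr_add)
    also have "E powr (-1) = 1 / E" using E by (simp add: powr_minus_divide)
    also have "(u\<^sup>2) powr (p - 1) = u powr (a - 1)"
      by (simp only: sq[OF u] pe)
    also have "(c\<^sup>2) powr (q - 1) = c powr (- a - 1)"
      by (simp only: sq[OF assms(3)] pe)
    finally have fg: "f (g u) = u powr (a - 1) * c powr (- a - 1) * E" by simp
    have "c powr (a - 1) * c powr (- a - 1) = 1 / c\<^sup>2"
      using assms by (simp add: powr_minus_divide flip: powr_add)
    moreover have "\<bar>g' u\<bar> = 2 * u * c\<^sup>2 / E\<^sup>2" using u by (simp add: g'_def E_def)
    ultimately have "c powr (a - 1) * (\<bar>g' u\<bar> * f (g u)) = (1 / c\<^sup>2) * (2 * u * c\<^sup>2 / E\<^sup>2 * (u powr (a - 1) * E))"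
      unfolding fg by (simp add: mult_ac)
    thus ?thesis using E assms unfolding E_def[symmetric] by (simp add: power2_eq_square)
  qed
  ultimately have "((\<lambda>u. u powr (a - 1) * (2 * u / (u\<^sup>2 + c\<^sup>2))) has_integral c powr (a - 1) * Beta p q) {0<..}"
    by (rule has_integral_eq[rotated])
  thus ?thesis unfolding p_def q_def
    by (intro nn_integral_has_integral_restrict) auto
qed

text \<open>This is \<open>coth(x/2)/2 - 1/x\<close>.\<close>
definition planck :: "real \<Rightarrow> real" where
  "planck x = (1 + exp (- x)) / (2 * (1 - exp (- x))) - 1 / x"

lemma planck_times_one_minus_exp:
  assumes "x > 0"
  shows "(1 - exp (- x)) * planck x = (1 + exp (- x)) / 2 - (1 - exp (- x)) / x"
proof -
  have "b * (A / (2 * b) - 1 / x) = A / 2 - b / x" if "b \<noteq> 0" for A b :: real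
    using that by (simp add: right_diff_distrib)
  from this[of "1 - exp (- x)"] show ?thesis using assms by (simp add: planck_def)
qed

lemma planck_nonneg:
  assumes "x > 0"
  shows "planck x \<ge> 0"
proof (rule sums_le[OF _ sums_zero])
  show "(\<lambda>k. 2 * x / (x\<^sup>2 + (2 * pi * real (Suc k))\<^sup>2)) sums planck x"
    unfolding planck_def by (rule planck_partial_fractions[OF assms])
qed (use assms in auto)

text \<open>Integrate \<open>h n x v\<close> over x and v in both orders. Integrating over x first
  gives \<open>Gamma (a + 2)\<close> times the kernel integral of a power, that is, the n-th
  trapezoidal term; integrating over v first gives \<open>planck x\<close> with the factor
  \<open>exp (- n * x)\<close> (1 - \<open>exp (- x)\<close>). Summing over n removes that factor by
  the geometric series. All integrands are nonnegative, so Tonelli applies in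
  \<open>ennreal\<close>.\<close>

lemma nn_integral_planck_eq_trapezoid:
  assumes "-1 < a" "a < 0"
  shows "(\<integral>\<^sup>+x. ennreal (indicator {0<..} x * (x powr (a - 1) * planck x)) \<partial>lborel)
           = ennreal (Gamma (a + 2)) * (\<Sum>n. ennreal (zeta_term_real n a / (a * (a + 1))))"
proof -
  define K where "K v = indicator {0..1} v * (v * (1 - v) / 2)" for v :: real
  have K: "0 \<le> K v" for v by (auto simp: K_def indicator_def)
  have [measurable]: "K \<in> borel_measurable borel" unfolding K_def by measurable
  define h where "h n x v = ennreal (K v * (indicator {0<..} x * (x powr (a + 1) * exp (- (real n + v) * x))))" for n :: nat and x v :: real
  have "(\<integral>\<^sup>+v. h n x v \<partial>lborel) = ennreal (indicator {0<..} x * (x powr (a - 1) * (exp (- real n * x) * (1 - exp (- x)) * planck x)))"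
    for n x
  proof (cases "x > 0")
    case True
    define c where "c = x powr (a + 1) * exp (- real n * x)"
    have "c \<ge> 0" by (simp add: c_def)
    have "(\<integral>\<^sup>+v. h n x v \<partial>lborel) = (\<integral>\<^sup>+v. ennreal c * ennreal (indicator {0..1} v * (v * (1 - v) / 2 * exp (- v * x))) \<partial>lborel)"
      using True \<open>c \<ge> 0\<close> by (intro nn_integral_cong)
        (simp add: h_def K_def c_def exp_add[symmetric] algebra_simps flip: ennreal_mult')
    also have "\<dots> = ennreal c * (\<integral>\<^sup>+v. ennreal (indicator {0..1} v * (v * (1 - v) / 2 * exp (- v * x))) \<partial>lborel)"
      by (intro nn_integral_cmult) measurable
    also have "(\<integral>\<^sup>+v. ennreal (indicator {0..1} v * (v * (1 - v) / 2 * exp (- v * x))) \<partial>lborel)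
        = ennreal (((1 + exp (- x)) / 2 - (1 - exp (- x)) / x) / x\<^sup>2)"
      by (rule nn_integral_has_integral_restrict[OF _ _ _ trapezoid_kernel_exp[OF True]]) auto
    also have "ennreal c * \<dots> = ennreal (c * (((1 + exp (- x)) / 2 - (1 - exp (- x)) / x) / x\<^sup>2))"
      using \<open>c \<ge> 0\<close> by (rule ennreal_mult'[symmetric])
    also have "c * (((1 + exp (- x)) / 2 - (1 - exp (- x)) / x) / x\<^sup>2) =
        x powr (a - 1) * (exp (- real n * x) * (1 - exp (- x)) * planck x)"
    proof -
      have "x powr (a - 1) = x powr (a + 1 - 2)" by simp
      also have "\<dots> = x powr (a + 1) / x\<^sup>2" using True unfolding powr_diff by simp
      finally have "c / x\<^sup>2 = x powr (a - 1) * exp (- real n * x)" by (simp add: c_def)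
      moreover have "(1 + exp (- x)) / 2 - (1 - exp (- x)) / x = (1 - exp (- x)) * planck x"
        using planck_times_one_minus_exp[OF True] by simp
      ultimately show ?thesis by (metis mult.assoc times_divide_eq_left times_divide_eq_right)
    qed
    finally show ?thesis using True by simp
  qed (auto simp: h_def)
  note int_v = this
  have "(\<integral>\<^sup>+x. h n x v \<partial>lborel) = ennreal (Gamma (a + 2)) * ennreal (indicator {0..1} v * (v * (1 - v) / 2 * (real n + v) powr (- a - 2)))"
    for n v
  \<comment> \<open>The Gamma integral needs n + v > 0, which fails for n = 0 and v = 0. At both
    endpoints, as outside the interval, \<open>K v = 0\<close> and both sides vanish.\<close>
  proof (cases "v \<in> {0<..<1}")
    case True
    hence "real n + v > 0" by (simp add: add_nonneg_pos)
    have "(\<integral>\<^sup>+x. h n x v \<partial>lborel) = ennreal (K v) * (\<integral>\<^sup>+x. ennreal (indicator {0<..} x * (x powr ((a + 2) - 1) * exp (- (real n + v) * x))) \<partial>lborel)"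
      unfolding h_def using K by (subst nn_integral_cmult[symmetric]) (auto simp: ennreal_mult' add.commute)
    also have "\<dots> = ennreal (K v) * ennreal (Gamma (a + 2) * (real n + v) powr (- (a + 2)))"
      using assms \<open>real n + v > 0\<close> by (subst nn_integral_Gamma_scaled) auto
    also have "\<dots> = ennreal (Gamma (a + 2)) * ennreal (K v * (real n + v) powr (- (a + 2)))"
    proof -
      have "Gamma (a + 2) \<ge> 0" using assms by (intro less_imp_le Gamma_real_pos) auto
      thus ?thesis unfolding ennreal_mult'[OF K, symmetric] ennreal_mult'[OF \<open>Gamma (a + 2) \<ge> 0\<close>, symmetric]
        by (simp only: mult.left_commute)
    qed
    finally show ?thesis by (simp add: K_def mult.assoc)
  next
    case False
    hence "K v = 0" by (auto simp: K_def indicator_def)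
    moreover from this have "indicator {0..1} v * (v * (1 - v) / 2 * (real n + v) powr (- a - 2)) = 0"
      by (auto simp: K_def)
    ultimately show ?thesis unfolding h_def by (simp only:) simp
  qed
  note int_x = this
  have tau: "(\<integral>\<^sup>+v. ennreal (indicator {0..1} v * (v * (1 - v) / 2 * (real n + v) powr (- a - 2))) \<partial>lborel)
      = ennreal (zeta_term_real n a / (a * (a + 1)))" for n
    by (rule nn_integral_has_integral_restrict[OF _ _ _ trapezoid_kernel_powr[OF assms]]) auto
  have "ennreal (Gamma (a + 2)) * (\<Sum>n. ennreal (zeta_term_real n a / (a * (a + 1)))) =
        (\<Sum>n. ennreal (Gamma (a + 2)) * (\<integral>\<^sup>+v. ennreal (indicator {0..1} v * (v * (1 - v) / 2 * (real n + v) powr (- a - 2))) \<partial>lborel))"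
    unfolding tau by (rule ennreal_suminf_cmult[symmetric])
  also have "\<dots> = (\<Sum>n. \<integral>\<^sup>+v. \<integral>\<^sup>+x. h n x v \<partial>lborel \<partial>lborel)"
    unfolding int_x by (intro suminf_cong nn_integral_cmult[symmetric]) measurable
  also have "\<dots> = (\<Sum>n. \<integral>\<^sup>+x. \<integral>\<^sup>+v. h n x v \<partial>lborel \<partial>lborel)"
  proof -
    have "(\<integral>\<^sup>+v. \<integral>\<^sup>+x. h n x v \<partial>lborel \<partial>lborel) = (\<integral>\<^sup>+x. \<integral>\<^sup>+v. h n x v \<partial>lborel \<partial>lborel)" for n
      unfolding h_def by (rule lborel_pair.Fubini') measurable
    thus ?thesis by simp
  qed
  also have "\<dots> = (\<integral>\<^sup>+x. (\<Sum>n. ennreal (indicator {0<..} x * (x powr (a - 1) * (exp (- real n * x) * (1 - exp (- x)) * planck x)))) \<partial>lborel)"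
    unfolding int_v by (rule nn_integral_suminf[symmetric]) (simp add: planck_def)
  also have "\<dots> = (\<integral>\<^sup>+x. ennreal (indicator {0<..} x * (x powr (a - 1) * planck x)) \<partial>lborel)"
  proof (intro nn_integral_cong)
    fix x :: real
    show "(\<Sum>n. ennreal (indicator {0<..} x * (x powr (a - 1) * (exp (- real n * x) * (1 - exp (- x)) * planck x)))) =
        ennreal (indicator {0<..} x * (x powr (a - 1) * planck x))"
    proof (cases "x > 0")
      case True
      have "(\<lambda>n. exp (- x) ^ n) sums (1 / (1 - exp (- x)))"
        using True by (intro geometric_sums) simp
      hence "(\<lambda>n. (x powr (a - 1) * ((1 - exp (- x)) * planck x)) * exp (- x) ^ n) sums
          ((x powr (a - 1) * ((1 - exp (- x)) * planck x)) * (1 / (1 - exp (- x))))"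
        by (rule sums_mult)
      also have "(\<lambda>n. (x powr (a - 1) * ((1 - exp (- x)) * planck x)) * exp (- x) ^ n) =
          (\<lambda>n. x powr (a - 1) * (exp (- real n * x) * (1 - exp (- x)) * planck x))"
        by (simp add: mult_ac flip: exp_of_nat_mult)
      also have "(x powr (a - 1) * ((1 - exp (- x)) * planck x)) * (1 / (1 - exp (- x))) = x powr (a - 1) * planck x"
        using True by simp
      finally have "(\<Sum>n. ennreal (x powr (a - 1) * (exp (- real n * x) * (1 - exp (- x)) * planck x))) = ennreal (x powr (a - 1) * planck x)"
        using planck_nonneg[OF True] True by (intro suminf_ennreal_eq) (auto simp: mult_ac intro!: mult_nonneg_nonneg)
      thus ?thesis using True by simp
    qed simp
  qed
  finally show ?thesis by simp
qed

text \<open>The partial fractions of \<open>planck\<close> are nonnegative and may be integrated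
  term by term; each gives a Beta integral with scale c = 2 pi (k + 1).\<close>

lemma nn_integral_planck_eq_dirichlet:
  assumes "-1 < a" "a < 0"
  shows "(\<integral>\<^sup>+x. ennreal (indicator {0<..} x * (x powr (a - 1) * planck x)) \<partial>lborel)
           = (\<Sum>k. ennreal ((2 * pi * real (Suc k)) powr (a - 1) * Beta ((1 + a) / 2) ((1 - a) / 2)))"
proof -
  define g where "g k x = indicator {0<..} x * (x powr (a - 1) * (2 * x / (x\<^sup>2 + (2 * pi * real (Suc k))\<^sup>2)))" for k and x :: real
  have g: "0 \<le> g k x" for k x
    by (auto simp: g_def indicator_def intro!: mult_nonneg_nonneg divide_nonneg_nonneg add_nonneg_nonneg)
  have "ennreal (indicator {0<..} x * (x powr (a - 1) * planck x)) = (\<Sum>k. ennreal (g k x))" for x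
  proof (cases "x > 0")
    case True
    have "(\<lambda>k. g k x) sums (indicator {0<..} x * (x powr (a - 1) * planck x))"
      unfolding g_def planck_def by (intro sums_mult planck_partial_fractions True)
    with g show ?thesis by (intro suminf_ennreal_eq[symmetric]) auto
  qed (auto simp: g_def)
  hence "(\<integral>\<^sup>+x. ennreal (indicator {0<..} x * (x powr (a - 1) * planck x)) \<partial>lborel) =
      (\<integral>\<^sup>+x. (\<Sum>k. ennreal (g k x)) \<partial>lborel)" by simp
  also have "\<dots> = (\<Sum>k. \<integral>\<^sup>+x. ennreal (g k x) \<partial>lborel)"
    unfolding g_def by (rule nn_integral_suminf) measurable
  also have "\<dots> = (\<Sum>k. ennreal ((2 * pi * real (Suc k)) powr (a - 1) * Beta ((1 + a) / 2) ((1 - a) / 2)))"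
    unfolding g_def using assms by (intro suminf_cong nn_integral_Beta_scaled) auto
  finally show ?thesis .
qed

subsection \<open>Functional equation\<close>

text \<open>The right-hand side of the functional equation. For Re s < 0 the argument 1 - s lies in
  the half-plane of convergence of the Dirichlet series and away from the poles of
  \<open>Gamma\<close>.\<close>

definition zeta_reflected :: "complex \<Rightarrow> complex" where
  "zeta_reflected s = 2 * of_real (2 * pi) powr (s - 1) * sin (of_real pi * s / 2)
     * Gamma (1 - s) * dirichlet_sum (1 - s)"

lemma holomorphic_zeta_reflected: "zeta_reflected holomorphic_on {s. Re s < 0}"
proof -
  have "(dirichlet_sum \<circ> (\<lambda>s. 1 - s)) holomorphic_on {s. Re s < 0}"
    by (rule holomorphic_on_compose_gen[OF _ holomorphic_dirichlet_sum]) (auto intro!: holomorphic_intros)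
  moreover have "(1 - s) \<notin> \<int>\<^sub>\<le>\<^sub>0" if "Re s < 0" for s :: complex
    using that by (auto elim!: nonpos_Ints_cases simp: complex_eq_iff)
  ultimately show ?thesis
    unfolding zeta_reflected_def[abs_def] o_def by (intro holomorphic_intros) auto
qed

lemma dirichlet_sum_of_real:
  assumes "b > 1"
  shows "(\<lambda>k. real (Suc k) powr (- b)) sums Re (dirichlet_sum (of_real b))"
    and "dirichlet_sum (of_real b) = of_real (Re (dirichlet_sum (of_real b)))"
proof -
  have "1 / (of_nat (Suc k) :: complex) powr of_real b = of_real (real (Suc k) powr (- b))" for k
    using powr_of_real[of "real (Suc k)" b] by (simp add: powr_minus_divide del: of_nat_Suc)
  hence *: "(\<lambda>k. of_real (real (Suc k) powr (- b))) sums dirichlet_sum (of_real b)"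
    using sums_dirichlet_sum[of "of_real b"] assms by simp
  from sums_Re[OF this] show **: "(\<lambda>k. real (Suc k) powr (- b)) sums Re (dirichlet_sum (of_real b))" by simp
  from sums_of_real[OF this, where 'a = complex] * show "dirichlet_sum (of_real b) = of_real (Re (dirichlet_sum (of_real b)))"
    by (rule sums_unique2[rotated])
qed

text \<open>Equate the two evaluations of the Mellin transform of \<open>planck\<close>. Both series
  converge in the reals, so the identity leaves \<open>ennreal\<close>, and Gamma(a + 2) = a (a + 1)
  Gamma(a) cancels the denominators.\<close>

lemma Gamma_mult_trapezoid_sum:
  assumes "-1 < a" "a < 0"
  shows "of_real (Gamma a) * trapezoid_sum (of_real a) =
      of_real ((2 * pi) powr (a - 1) * Beta ((1 + a) / 2) ((1 - a) / 2)) * dirichlet_sum (of_real (1 - a))"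
proof -
  define B where "B = Beta ((1 + a) / 2) ((1 - a) / 2)"
  define D where "D = Re (dirichlet_sum (of_real (1 - a)))"
  define S where "S = (2 * pi) powr (a - 1) * B * D"
  have B: "B \<ge> 0"
  proof -
    have "(1 + a) / 2 + (1 - a) / 2 = 1" by (simp add: field_simps)
    thus ?thesis unfolding B_def Beta_def using assms
      by (simp add: less_imp_le[OF Gamma_real_pos])
  qed
  have aa: "a * (a + 1) < 0" using assms by (intro mult_neg_pos) auto
  have G: "Gamma (a + 2) = a * (a + 1) * Gamma a"
  proof -
    have "a \<notin> \<int>\<^sub>\<le>\<^sub>0" "a + 1 \<notin> \<int>\<^sub>\<le>\<^sub>0" using assms by (auto elim!: nonpos_Ints_cases)
    thus ?thesis using Gamma_plus1[of a] Gamma_plus1[of "a + 1"] by (simp add: add.assoc mult_ac)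
  qed
  have "(\<lambda>k. real (Suc k) powr (a - 1)) sums D"
    using dirichlet_sum_of_real(1)[of "1 - a"] assms by (simp add: D_def)
  hence "(\<lambda>k. (2 * pi) powr (a - 1) * B * real (Suc k) powr (a - 1)) sums S"
    unfolding S_def by (rule sums_mult)
  moreover have "(2 * pi * real (Suc k)) powr (a - 1) * B = (2 * pi) powr (a - 1) * B * real (Suc k) powr (a - 1)" for k
    by (simp add: powr_mult mult_ac del: of_nat_Suc)
  ultimately have "(\<lambda>k. (2 * pi * real (Suc k)) powr (a - 1) * B) sums S" by (simp only:)
  hence "(\<Sum>k. ennreal ((2 * pi * real (Suc k)) powr (a - 1) * B)) = ennreal S"
    using B by (intro suminf_ennreal_eq) auto
  hence eq: "ennreal (Gamma (a + 2)) * (\<Sum>n. ennreal (zeta_term_real n a / (a * (a + 1)))) = ennreal S"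
    using nn_integral_planck_eq_trapezoid[OF assms] nn_integral_planck_eq_dirichlet[OF assms]
    by (simp add: B_def)
  have nn: "zeta_term_real n a / (a * (a + 1)) \<ge> 0" for n
    using has_integral_nonneg[OF trapezoid_kernel_powr[OF assms, of n]] by auto
  define T where "T = Re (trapezoid_sum (of_real a))"
  have s: "(\<lambda>n. of_real (zeta_term_real n a)) sums trapezoid_sum (of_real a)"
    using sums_trapezoid_sum[of "of_real a"] assms by (simp add: zeta_term_of_real)
  from sums_Re[OF this] have T: "(\<lambda>n. zeta_term_real n a) sums T" by (simp add: T_def)
  from sums_of_real[OF this, where 'a = complex] s have T': "trapezoid_sum (of_real a) = of_real T"
    by (rule sums_unique2[rotated])
  have sT: "(\<lambda>n. zeta_term_real n a / (a * (a + 1))) sums (T / (a * (a + 1)))"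
    by (rule sums_divide[OF T])
  have T0: "T / (a * (a + 1)) \<ge> 0"
    by (rule sums_le[OF _ sums_zero sT]) (rule nn)
  have "(\<Sum>n. ennreal (zeta_term_real n a / (a * (a + 1)))) = ennreal (T / (a * (a + 1)))"
    by (intro suminf_ennreal_eq nn sT)
  with eq have "ennreal (Gamma (a + 2) * (T / (a * (a + 1)))) = ennreal S"
    using assms by (subst ennreal_mult') (auto intro!: less_imp_le[OF Gamma_real_pos])
  moreover have "S \<ge> 0"
    unfolding S_def D_def using B assms
    by (intro mult_nonneg_nonneg sums_le[OF _ sums_zero dirichlet_sum_of_real(1)]) auto
  moreover have "Gamma (a + 2) * (T / (a * (a + 1))) \<ge> 0"
    using T0 assms by (intro mult_nonneg_nonneg less_imp_le[OF Gamma_real_pos]) auto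
  \<comment> \<open>\<open>ennreal\<close> is injective only on nonnegative reals, hence the two
    preceding sign checks.\<close>
  ultimately have "Gamma (a + 2) * (T / (a * (a + 1))) = S" by (simp add: ennreal_inj)
  hence "Gamma a * T = S" using aa unfolding G by auto
  hence "of_real (Gamma a) * trapezoid_sum (of_real a) = of_real S" unfolding T' by (simp flip: of_real_mult)
  also have "of_real S = of_real ((2 * pi) powr (a - 1) * B) * dirichlet_sum (of_real (1 - a))"
    using dirichlet_sum_of_real(2)[of "1 - a"] assms by (simp add: S_def D_def)
  finally show "of_real (Gamma a) * trapezoid_sum (of_real a) =
      of_real ((2 * pi) powr (a - 1) * Beta ((1 + a) / 2) ((1 - a) / 2)) * dirichlet_sum (of_real (1 - a))"
    unfolding B_def .
qed

text \<open>At an integer both sides are 0: one \<open>Gamma\<close> factor sits at a pole, where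
  its value is 0, and the right-hand side divides by 0.\<close>

lemma Gamma_reflection_real:
  fixes x :: real
  shows "Gamma x * Gamma (1 - x) = pi / sin (pi * x)"
proof -
  have "complex_of_real (Gamma x * Gamma (1 - x)) = Gamma (of_real x) * Gamma (1 - of_real x)"
    using Gamma_complex_of_real[of "1 - x"] by (simp add: Gamma_complex_of_real)
  also have "\<dots> = of_real pi / sin (of_real (pi * x))"
    unfolding Gamma_reflection_complex by simp
  also have "\<dots> = of_real (pi / sin (pi * x))" by (simp only: sin_of_real of_real_divide)
  finally have "complex_of_real (Gamma x * Gamma (1 - x)) = of_real (pi / sin (pi * x))" .
  thus ?thesis by (simp only: of_real_eq_iff)
qed

text \<open>The Beta arguments add up to 1, so reflection gives pi / cos(pi a / 2). Reflection at a
  itself together with the double angle formula expresses the same quantity as Gamma(a) times 2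
  sin(pi a / 2) Gamma(1 - a), and the nonzero Gamma(a) cancels.\<close>

lemma trapezoid_sum_eq_reflected_real:
  assumes "-1 < a" "a < 0"
  shows "trapezoid_sum (of_real a) = zeta_reflected (of_real a)"
proof -
  have "a \<notin> \<int>" using assms by (auto elim!: Ints_cases)
  have pa: "- pi < pi * a" "pi * a < 0"
    using mult_strict_left_mono[OF assms(1) pi_gt_zero] assms(2) by (simp_all add: mult_pos_neg)
  have c: "cos (pi * a / 2) > 0"
    using pa by (intro cos_gt_zero_pi) linarith+
  have "sin (- (pi * a / 2)) > 0" using pa pi_gt_zero by (intro sin_gt_zero) linarith+
  hence s: "sin (pi * a / 2) \<noteq> 0" by simp
  have s2: "sin (pi * a) = 2 * sin (pi * a / 2) * cos (pi * a / 2)"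
    using sin_double[of "pi * a / 2"] by simp
  have "Beta ((1 + a) / 2) ((1 - a) / 2) = Gamma ((1 + a) / 2) * Gamma (1 - (1 + a) / 2)"
    by (simp add: Beta_def field_simps)
  also have "\<dots> = pi / sin (pi * a / 2 + pi / 2)" unfolding Gamma_reflection_real by (simp add: field_simps)
  also have "\<dots> = pi / cos (pi * a / 2)" by (simp add: sin_add)
  finally have B: "Beta ((1 + a) / 2) ((1 - a) / 2) = pi / cos (pi * a / 2)" .
  have G: "Gamma a * (2 * sin (pi * a / 2) * Gamma (1 - a)) = pi / cos (pi * a / 2)"
    using Gamma_reflection_real[of a] c s unfolding s2 by (simp add: field_simps)
  have g0: "Gamma a \<noteq> 0" using \<open>a \<notin> \<int>\<close> by (auto simp: Gamma_eq_zero_iff elim!: nonpos_Ints_cases)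
  have "of_real (Gamma a) * trapezoid_sum (of_real a) =
      of_real ((2 * pi) powr (a - 1) * (Gamma a * (2 * sin (pi * a / 2) * Gamma (1 - a)))) * dirichlet_sum (of_real (1 - a))"
    unfolding Gamma_mult_trapezoid_sum[OF assms] B G ..
  also have "\<dots> = of_real (Gamma a) * (2 * of_real ((2 * pi) powr (a - 1)) * of_real (sin (pi * a / 2)) * of_real (Gamma (1 - a)) * dirichlet_sum (of_real (1 - a)))"
    by (simp add: mult_ac)
  also have "(of_real ((2 * pi) powr (a - 1)) :: complex) = of_real (2 * pi) powr (of_real a - 1)"
    using powr_of_real[of "2 * pi" "a - 1"] by simp
  also have "(of_real (sin (pi * a / 2)) :: complex) = sin (of_real pi * of_real a / 2)"
    by (simp flip: sin_of_real)
  also have "(of_real (Gamma (1 - a)) :: complex) = Gamma (1 - of_real a)"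
    by (simp flip: Gamma_complex_of_real)
  finally show ?thesis using g0 by (simp add: zeta_reflected_def)
qed

lemma trapezoid_sum_eq_reflected:
  assumes "-1 < Re s" "Re s < 0"
  shows "trapezoid_sum s = zeta_reflected s"
proof -
  let ?S = "{s. Re s > -1} \<inter> {s. Re s < 0}"
  let ?U = "complex_of_real ` {-1<..<0}"
  have "trapezoid_sum s - zeta_reflected s = 0"
  \<comment> \<open>Identity theorem on the connected strip: the difference vanishes on the real
    segment, which accumulates at the interior point -1/2.\<close>
  proof (rule analytic_continuation[where f = "\<lambda>s. trapezoid_sum s - zeta_reflected s" and S = ?S and U = ?U and \<xi> = "of_real (-1/2)"])
    show "(\<lambda>s. trapezoid_sum s - zeta_reflected s) holomorphic_on ?S"
      by (intro holomorphic_intros holomorphic_on_subset[OF holomorphic_trapezoid_sum]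
            holomorphic_on_subset[OF holomorphic_zeta_reflected]) auto
    show "open ?S" by (intro open_Int open_halfspace_Re_gt open_halfspace_Re_lt)
    show "connected ?S"
      by (intro convex_connected convex_Int convex_halfspace_Re_gt convex_halfspace_Re_lt)
    have "(-1/2 :: real) islimpt {-1<..<0}" by (rule open_imp_islimpt) auto
    thus "complex_of_real (-1/2) islimpt ?U"
    proof (rule islimpt_isCont_image)
      show "\<forall>\<^sub>F x in at (-1/2). complex_of_real x \<noteq> of_real (-1/2)"
        by (simp only: of_real_eq_iff eventually_neq_at_within)
    qed simp
  qed (use assms trapezoid_sum_eq_reflected_real in auto)
  thus ?thesis by simp
qed

text \<open>The two holomorphic pieces agree on the overlap -1 < Re s < 0 by the functional
  equation, and their domains cover the plane without 1. Together with uniqueness this identifies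
  the function selected by \<open>zeta\<close>.\<close>

lemma zeta_continuation_exists:
  "zeta_continuation (\<lambda>s. if s \<in> {s. Re s < 0} then zeta_reflected s else if s = 1 then 0 else trapezoid_sum s)"
  (is "zeta_continuation ?f")
proof -
  have "(\<lambda>s. if s \<in> {s. Re s < 0} then zeta_reflected s else if s = 1 then 0 else trapezoid_sum s) holomorphic_on
        ({s. Re s < 0} \<union> ({s. Re s > -1} - {1}))"
  proof (rule holomorphic_on_If_Un)
    show "zeta_reflected holomorphic_on {s. Re s < 0}" by (rule holomorphic_zeta_reflected)
    show "(\<lambda>s. if s = 1 then 0 else trapezoid_sum s) holomorphic_on {s. Re s > -1} - {1}"
      using holomorphic_trapezoid_sum by (rule holomorphic_transform) auto
    show "zeta_reflected z = (if z = 1 then 0 else trapezoid_sum z)"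
      if "z \<in> {s. Re s < 0}" "z \<in> {s. Re s > -1} - {1}" for z
      using that trapezoid_sum_eq_reflected[of z] by simp
  qed (auto intro!: open_Diff open_halfspace_Re_lt open_halfspace_Re_gt)
  moreover have "- {1} = {s. Re s < 0} \<union> ({s. Re s > -1} - {1})" by auto
  ultimately have "?f holomorphic_on (- {1})" by simp
  moreover have "(\<lambda>n. 1 / of_nat (Suc n) powr s) sums ?f s" if "Re s > 1" for s
    using that sums_dirichlet_sum[OF that] trapezoid_sum_eq_dirichlet_sum[OF that] by auto
  ultimately show ?thesis by (simp add: zeta_continuation_def)
qed

theorem zeta_functional_equation:
  assumes "Re s < 0"
  shows "zeta s = 2 * of_real (2 * pi) powr (s - 1) * sin (of_real pi * s / 2)
     * Gamma (1 - s) * dirichlet_sum (1 - s)"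
  using assms unfolding zeta_eqI[OF zeta_continuation_exists] by (simp add: zeta_reflected_def)

subsection \<open>Stirling bound for the complex Gamma function\<close>

text \<open>The trapezoidal error of \<open>Ln\<close> on \<open>[w, w + 1]\<close>, whose antiderivative is \<open>z Ln z - z\<close>.\<close>
lemma Ln_trapezoid_bound:
  assumes "Re w > 0"
  shows "norm ((w + 1 / 2) * (Ln (w + 1) - Ln w) - 1) \<le> 1 / (8 * (Re w)\<^sup>2)"
proof -
  let ?F = "\<lambda>z. (w + z) * Ln (w + z) - (w + z)"
  have nz: "w + of_real v \<notin> \<real>\<^sub>\<le>\<^sub>0" "w + of_real v \<noteq> 0" if "v \<in> {0..1}" for v
    using that assms by (auto simp: complex_nonpos_Reals_iff complex_eq_iff)
  have "norm ((Ln (w + 0) + Ln (w + 1)) / 2 - (?F 1 - ?F 0)) \<le> (1 / (Re w)\<^sup>2) / 8"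
  proof (rule norm_trapezoid_error_le[where f = "\<lambda>z. Ln (w + z)" and f' = "\<lambda>z. 1 / (w + z)"
        and f'' = "\<lambda>z. - 1 / (w + z)\<^sup>2"])
    fix v :: real assume v: "v \<in> {0..1}"
    show "(?F has_field_derivative Ln (w + of_real v)) (at (of_real v))"
      using nz[OF v] by (auto intro!: derivative_eq_intros)
    show "((\<lambda>z. Ln (w + z)) has_field_derivative 1 / (w + of_real v)) (at (of_real v))"
      using nz[OF v] by (auto intro!: derivative_eq_intros simp: inverse_eq_divide)
    show "((\<lambda>z. 1 / (w + z)) has_field_derivative - 1 / (w + of_real v)\<^sup>2) (at (of_real v))"
      using nz[OF v] by (auto intro!: derivative_eq_intros simp: power2_eq_square)
    have "Re w \<le> Re (w + of_real v)" using v by simp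
    also have "\<dots> \<le> norm (w + of_real v)" by (rule complex_Re_le_cmod)
    finally have "(Re w)\<^sup>2 \<le> (norm (w + of_real v))\<^sup>2" using assms by (intro power_mono) auto
    thus "norm (- 1 / (w + of_real v)\<^sup>2) \<le> 1 / (Re w)\<^sup>2"
      using assms by (simp add: norm_divide norm_power frac_le)
  qed
  also have "(Ln (w + 0) + Ln (w + 1)) / 2 - (?F 1 - ?F 0) = - ((w + 1 / 2) * (Ln (w + 1) - Ln w) - 1)"
    by (simp add: field_simps)
  finally show ?thesis by (simp only: norm_minus_cancel) (simp add: mult.commute)
qed

text \<open>Stirling's approximation of \<open>ln \<Gamma>(w)\<close>, up to an additive constant.\<close>
definition stirling_exponent :: "complex \<Rightarrow> complex" where
  "stirling_exponent w = (w - 1 / 2) * Ln w - w"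

text \<open>The increment of \<open>stirling_exponent\<close> from w to w + 1 is \<open>Ln w\<close>
  plus exactly the quantity bounded in \<open>Ln_trapezoid_bound\<close>.\<close>

lemma stirling_exponent_step:
  assumes "Re w > 0"
  shows "Re (Ln w) \<ge> Re (stirling_exponent (w + 1)) - Re (stirling_exponent w) - 1 / (8 * (Re w)\<^sup>2)"
proof -
  have "stirling_exponent (w + 1) - stirling_exponent w = Ln w + ((w + 1 / 2) * (Ln (w + 1) - Ln w) - 1)"
    by (simp add: stirling_exponent_def field_simps)
  hence "Re (stirling_exponent (w + 1)) - Re (stirling_exponent w) =
      Re (Ln w) + Re ((w + 1 / 2) * (Ln (w + 1) - Ln w) - 1)"
    by (metis minus_complex.simps(1) plus_complex.simps(1))
  also have "Re ((w + 1 / 2) * (Ln (w + 1) - Ln w) - 1) \<le> 1 / (8 * (Re w)\<^sup>2)"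
    using Ln_trapezoid_bound[OF assms] complex_Re_le_cmod order_trans by blast
  finally show ?thesis by simp
qed

text \<open>Multiply the one-step bounds at w, ..., w + n - 1. With r the real part of the current
  factor, the error 1 / (8 r^2) is at most (1 / (r - 1) - 1 / r) / 8, which telescopes; for Re w
  \<ge> 2 the total error is at most 1/8.\<close>

lemma norm_pochhammer_ge:
  assumes "Re w \<ge> 2"
  shows "norm (pochhammer w n) \<ge>
    exp (Re (stirling_exponent (w + of_nat n)) - Re (stirling_exponent w) - 1 / 8 * (1 / (Re w - 1) - 1 / (Re w + n - 1)))"
proof (induction n)
  case 0
  thus ?case by simp
next
  case (Suc n)
  let ?u = "w + of_nat n"
  have u: "Re ?u \<ge> 2" using assms by simp
  hence "?u \<noteq> 0" by (metis not_numeral_le_zero zero_complex.sel(1))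
  have "1 / (8 * (Re ?u)\<^sup>2) \<le> 1 / 8 * (1 / (Re ?u - 1) - 1 / Re ?u)"
  proof -
    have "1 / (Re ?u - 1) - 1 / Re ?u = 1 / ((Re ?u - 1) * Re ?u)" using u by (simp add: field_simps)
    also have "\<dots> \<ge> 1 / (Re ?u)\<^sup>2" unfolding power2_eq_square using u
      by (intro divide_left_mono mult_right_mono mult_pos_pos) auto
    finally show ?thesis by simp
  qed
  hence "Re (stirling_exponent (?u + 1)) - Re (stirling_exponent ?u) - 1 / 8 * (1 / (Re ?u - 1) - 1 / Re ?u) \<le> Re (Ln ?u)"
    using stirling_exponent_step[of ?u] u by linarith
  hence "exp (Re (stirling_exponent (?u + 1)) - Re (stirling_exponent ?u) - 1 / 8 * (1 / (Re ?u - 1) - 1 / Re ?u)) \<le> norm ?u"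
    using \<open>?u \<noteq> 0\<close> by (simp add: ln_ge_iff)
  hence "exp (Re (stirling_exponent ?u) - Re (stirling_exponent w) - 1 / 8 * (1 / (Re w - 1) - 1 / (Re w + n - 1))) *
     exp (Re (stirling_exponent (?u + 1)) - Re (stirling_exponent ?u) - 1 / 8 * (1 / (Re ?u - 1) - 1 / Re ?u)) \<le> norm (pochhammer w (Suc n))"
    unfolding pochhammer_Suc norm_mult using Suc by (intro mult_mono) auto
  also have "exp (Re (stirling_exponent ?u) - Re (stirling_exponent w) - 1 / 8 * (1 / (Re w - 1) - 1 / (Re w + n - 1))) *
     exp (Re (stirling_exponent (?u + 1)) - Re (stirling_exponent ?u) - 1 / 8 * (1 / (Re ?u - 1) - 1 / Re ?u)) =
     exp (Re (stirling_exponent (w + of_nat (Suc n))) - Re (stirling_exponent w) - 1 / 8 * (1 / (Re w - 1) - 1 / (Re w + Suc n - 1)))"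
    unfolding exp_add[symmetric] by (simp add: algebra_simps)
  finally show ?case .
qed

text \<open>The constant 1 in the exponent makes n = 1 an equality. The induction step is (n + 1/2)
  (ln(n + 1) - ln n) \<ge> 1, the midpoint lower bound for the integral of the convex function 1 /
  t.\<close>

lemma fact_le_stirling:
  assumes "n > 0"
  shows "fact n \<le> exp (1 + (real n + 1 / 2) * ln (real n) - real n)"
  using assms
proof (induction n rule: nat_induct_non_zero)
  case 1
  thus ?case by simp
next
  case (Suc n)
  have "2 * (real (Suc n) - real n) / (real n + real (Suc n)) \<le> ln (real (Suc n)) - ln (real n)"
    using \<open>n > 0\<close> by (intro ln_inverse_approx_ge) auto
  hence *: "(real n + 1 / 2) * (ln (real (Suc n)) - ln (real n)) \<ge> 1"
    using \<open>n > 0\<close> by (simp add: field_simps)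
  have "fact (Suc n) = exp (ln (real (Suc n))) * fact n" by simp
  also have "\<dots> \<le> exp (ln (real (Suc n))) * exp (1 + (real n + 1 / 2) * ln (real n) - real n)"
    using Suc by (intro mult_left_mono) auto
  also have "\<dots> = exp (ln (real (Suc n)) + (1 + (real n + 1 / 2) * ln (real n) - real n))"
    by (simp only: exp_add)
  also have "\<dots> \<le> exp (1 + (real (Suc n) + 1 / 2) * ln (real (Suc n)) - real (Suc n))"
    using * by (simp add: algebra_simps)
  finally show ?case .
qed

lemma Re_stirling_exponent:
  assumes "Re w > 0"
  shows "Re (stirling_exponent w) = (Re w - 1 / 2) * ln (norm w) - Im w * arctan (Im w / Re w) - Re w"
proof -
  have "w \<noteq> 0" using assms by auto
  thus ?thesis using arg_conv_arctan[OF assms]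
    by (simp add: stirling_exponent_def Arg_eq_Im_Ln)
qed

text \<open>Uses \<bar>arctan u\<bar> \<le> \<bar>u\<bar>. The bound serves at w + N + 1, where the
  loss (Im w)^2 / Re(w + N + 1) tends to 0 as N grows.\<close>

lemma Re_stirling_exponent_ge:
  assumes "Re w > 1 / 2"
  shows "Re (stirling_exponent w) \<ge> (Re w - 1 / 2) * ln (Re w) - (Im w)\<^sup>2 / Re w - Re w"
proof -
  have "ln (Re w) \<le> ln (norm w)"
    using assms complex_Re_le_cmod[of w] by (intro ln_mono) auto
  hence "(Re w - 1 / 2) * ln (Re w) \<le> (Re w - 1 / 2) * ln (norm w)"
    using assms by (intro mult_left_mono) auto
  moreover have "Im w * arctan (Im w / Re w) \<le> (Im w)\<^sup>2 / Re w"
  proof -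
    have "Im w * arctan (Im w / Re w) \<le> \<bar>Im w\<bar> * \<bar>Im w / Re w\<bar>"
      unfolding abs_le_iff by (rule order_trans[OF abs_ge_self]) (auto simp: abs_mult abs_arctan_le mult_left_mono simp del: abs_divide)
    thus ?thesis using assms by (simp add: power2_eq_square)
  qed
  ultimately show ?thesis using Re_stirling_exponent[of w] assms by linarith
qed

text \<open>For Im w nonzero, arctan(Im w / Re w) is pi/2 with the sign of Im w, minus arctan(Re w /
  Im w). The first part produces the exponential decay; the second contributes at most Re w, which
  the term -Re w compensates.\<close>

lemma Re_stirling_exponent_le:
  assumes "Re w > 0"
  shows "Re (stirling_exponent w) \<le> (Re w - 1 / 2) * ln (norm w) - pi * \<bar>Im w\<bar> / 2"
proof (cases "Im w = 0")
  case True
  thus ?thesis using Re_stirling_exponent[OF assms] assms by simp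
next
  case False
  have "Re w / Im w \<noteq> 0" using assms False by auto
  from Transcendental.arctan_inverse[OF this] have *: "arctan (Im w / Re w) = sgn (Re w / Im w) * pi / 2 - arctan (Re w / Im w)"
    by simp
  have "Im w * arctan (Re w / Im w) \<le> \<bar>Im w\<bar> * \<bar>Re w / Im w\<bar>"
    by (rule order_trans[OF abs_ge_self]) (auto simp: abs_mult abs_arctan_le mult_left_mono simp del: abs_divide)
  also have "\<dots> = Re w" using False assms by simp
  finally have "Im w * arctan (Re w / Im w) \<le> Re w" .
  moreover have "Im w * (sgn (Re w / Im w) * pi / 2) = pi * \<bar>Im w\<bar> / 2"
    using assms False by (cases "Im w > 0") (auto simp: sgn_if zero_less_divide_iff)
  ultimately show ?thesis unfolding Re_stirling_exponent[OF assms] * right_diff_distrib by linarith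
qed

text \<open>Bound Euler's product \<open>Gamma_series\<close> for fixed N and let N tend to
  infinity. The constant is 9/8 = 1 + 1/8: the 1 comes from the factorial and the 1/8 from the
  Pochhammer symbol.\<close>

lemma norm_Gamma_le_stirling:
  assumes "Re w \<ge> 2"
  shows "norm (Gamma w) \<le> exp (9 / 8 + Re (stirling_exponent w))"
proof (rule tendsto_le[OF sequentially_bot])
  define x y where "x = Re w" and "y = Im w"
  \<comment> \<open>The part of the exponent that depends on N: the factorial bound and the power of
    N, minus the lower bound for \<open>stirling_exponent\<close> at w + N + 1.\<close>
  define b where "b N = (real N + 1 / 2 + x) * ln (real N) - real N
      - ((x + real N + 1 / 2) * ln (x + real N + 1) - y\<^sup>2 / (x + real N + 1) - (x + real N + 1))" for N :: nat
  show "(\<lambda>N. norm (Gamma_series w N)) \<longlonglongrightarrow> norm (Gamma w)"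
    by (intro tendsto_norm Gamma_series_LIMSEQ)
  have "b \<longlonglongrightarrow> 0"
    unfolding b_def by real_asymp
  hence "(\<lambda>N. exp (9 / 8 + Re (stirling_exponent w) + b N)) \<longlonglongrightarrow> exp (9 / 8 + Re (stirling_exponent w) + 0)"
    by (intro tendsto_intros)
  thus "(\<lambda>N. exp (9 / 8 + Re (stirling_exponent w) + b N)) \<longlonglongrightarrow> exp (9 / 8 + Re (stirling_exponent w))" by simp
  show "\<forall>\<^sub>F N in sequentially. norm (Gamma_series w N) \<le> exp (9 / 8 + Re (stirling_exponent w) + b N)"
    using eventually_gt_at_top[of 0]
  proof eventually_elim
    case (elim N)
    let ?P = "Re (stirling_exponent (w + of_nat (N + 1))) - Re (stirling_exponent w) - 1 / 8"
    have "1 / (Re w - 1) \<le> 1" using assms by simp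
    moreover have "1 / (Re w + real (N + 1) - 1) \<ge> 0" using assms by simp
    ultimately have "1 / (Re w - 1) - 1 / (Re w + real (N + 1) - 1) \<le> 1" by (metis diff_ge_0_iff_ge diff_mono diff_zero)
    hence "?P \<le> Re (stirling_exponent (w + of_nat (N + 1))) - Re (stirling_exponent w) -
        1 / 8 * (1 / (Re w - 1) - 1 / (Re w + real (N + 1) - 1))"
      by (intro diff_left_mono mult_left_le) auto
    hence "exp ?P \<le> norm (pochhammer w (N + 1))"
      using norm_pochhammer_ge[OF assms, of "N + 1"] by (meson exp_le_cancel_iff order_trans)
    hence "norm (Gamma_series w N) \<le> fact N * exp (x * ln (real N)) / exp ?P"
      unfolding Gamma_series_def x_def using elim
      by (simp add: norm_mult norm_divide norm_fact frac_le del: pochhammer_Suc)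
    also have "\<dots> \<le> exp (1 + (real N + 1 / 2) * ln (real N) - real N) * exp (x * ln (real N)) / exp ?P"
      using fact_le_stirling[OF elim] by (intro divide_right_mono mult_right_mono) auto
    also have "\<dots> = exp (1 + (real N + 1 / 2) * ln (real N) - real N + x * ln (real N) - ?P)"
      by (simp only: exp_add exp_diff)
    also have "\<dots> \<le> exp (9 / 8 + Re (stirling_exponent w) + b N)"
    proof -
      have "Re (w + of_nat (N + 1)) > 1 / 2" using assms by simp
      from Re_stirling_exponent_ge[OF this]
      have "Re (stirling_exponent (w + of_nat (N + 1))) \<ge>
        (x + real N + 1 / 2) * ln (x + real N + 1) - y\<^sup>2 / (x + real N + 1) - (x + real N + 1)"
        by (simp add: x_def y_def add_ac)
      thus ?thesis unfolding exp_le_cancel_iff b_def by (simp add: algebra_simps)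
    qed
    finally show ?case .
  qed
qed

lemma norm_Gamma_le:
  assumes "Re w \<ge> 2"
  shows "norm (Gamma w) \<le> exp (9 / 8) * norm w powr (Re w - 1 / 2) * exp (- pi * \<bar>Im w\<bar> / 2)"
proof -
  have w: "norm w > 0" using assms by auto
  have "norm (Gamma w) \<le> exp (9 / 8 + ((Re w - 1 / 2) * ln (norm w) - pi * \<bar>Im w\<bar> / 2))"
    using norm_Gamma_le_stirling[OF assms] Re_stirling_exponent_le[of w] assms
    by (smt (verit) exp_le_cancel_iff)
  also have "\<dots> = exp (9 / 8) * norm w powr (Re w - 1 / 2) * exp (- pi * \<bar>Im w\<bar> / 2)"
    using w by (simp add: powr_def exp_add[symmetric])
  finally show ?thesis .
qed

subsection \<open>The estimate\<close>

text \<open>Termwise comparison with the Basel series.\<close>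

lemma norm_dirichlet_sum_le:
  assumes "Re s \<ge> 2"
  shows "norm (dirichlet_sum s) \<le> pi\<^sup>2 / 6"
proof -
  have "norm (1 / of_nat (Suc n) powr s) \<le> 1 / (of_nat n + 1)\<^sup>2" for n
  proof -
    have "(of_nat n + 1)\<^sup>2 = real (Suc n) powr 2" by (simp add: add.commute)
    also have "\<dots> \<le> real (Suc n) powr Re s" using assms by (intro powr_mono) auto
    finally show ?thesis by (simp add: norm_divide norm_nat_powr frac_le del: of_nat_Suc)
  qed
  moreover have ss: "(\<lambda>n. 1 / (real n + 1)\<^sup>2) sums (pi\<^sup>2 / 6)"
    using inverse_squares_sums by (simp add: add.commute)
  ultimately have "norm (\<Sum>n. 1 / of_nat (Suc n) powr s) \<le> (\<Sum>n. 1 / (real n + 1)\<^sup>2)"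
    by (intro norm_suminf_le sums_summable[OF ss])
  thus ?thesis unfolding dirichlet_sum_def sums_unique[OF ss, symmetric] .
qed

lemma norm_sin_le_exp: "norm (sin z) \<le> exp \<bar>Im z\<bar>" for z :: complex
proof -
  have "norm (sin z) = norm (exp (\<i> * z) - exp (- (\<i> * z))) / 2"
    by (simp add: sin_exp_eq norm_divide norm_mult)
  also have "\<dots> \<le> (norm (exp (\<i> * z)) + norm (exp (- (\<i> * z)))) / 2"
    by (intro divide_right_mono norm_triangle_ineq4) auto
  also have "\<dots> = (exp (- Im z) + exp (Im z)) / 2" by simp
  also have "\<dots> \<le> (exp \<bar>Im z\<bar> + exp \<bar>Im z\<bar>) / 2"
    by (intro divide_right_mono add_mono) auto
  finally show ?thesis by simp
qed

theorem proposition7: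
  fixes \<sigma> t :: real
  assumes "\<sigma> \<le> -1" and "\<bar>t\<bar> \<ge> 1 / 2"
  shows "norm (zeta (Complex \<sigma> t))
           \<le> 2 * (2 * pi) powr \<sigma> * ((1 - \<sigma>)\<^sup>2 + t\<^sup>2) powr (1 / 4 - \<sigma> / 2)"
proof -
  let ?s = "Complex \<sigma> t"
  \<comment> \<open>With w = 1 - s the Stirling exponent Re w - 1/2 is 1/2 - \<sigma>; writing the
    norm as a square root halves it to the exponent of the claim.\<close>
  define R where "R = norm (1 - ?s) powr (1 / 2 - \<sigma>)"
  have sin: "norm (sin (of_real pi * ?s / 2)) \<le> exp (pi * \<bar>t\<bar> / 2)"
    using norm_sin_le_exp[of "of_real pi * ?s / 2"] by (simp add: abs_mult)
  have Gamma: "norm (Gamma (1 - ?s)) \<le> exp (9 / 8) * R * exp (- pi * \<bar>t\<bar> / 2)"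
    using norm_Gamma_le[of "1 - ?s"] assms(1) by (simp add: R_def)
  have pow: "norm (complex_of_real (2 * pi) powr (?s - 1)) = (2 * pi) powr \<sigma> / (2 * pi)"
    by (subst norm_powr_real_powr) (auto simp: powr_diff)
  have R: "((1 - \<sigma>)\<^sup>2 + t\<^sup>2) powr (1 / 4 - \<sigma> / 2) = R"
  proof -
    have "norm (1 - ?s) = sqrt ((1 - \<sigma>)\<^sup>2 + t\<^sup>2)" by (simp add: cmod_def)
    also have "\<dots> = ((1 - \<sigma>)\<^sup>2 + t\<^sup>2) powr (1 / 2)" by (simp add: powr_half_sqrt)
    finally show ?thesis by (simp add: R_def powr_powr field_simps)
  qed
  \<comment> \<open>Equivalent to e^(9/8) \<le> 12 / pi, shown from e < 2.72 and the bound 1 + x +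
    x^2 for e^x at x = 1/8.\<close>
  have const: "exp (9 / 8) * (pi\<^sup>2 / 6) \<le> 2 * pi"
  proof -
    have "exp (9 / 8 :: real) = exp 1 * exp (1 / 8)" by (simp flip: exp_add)
    also have "\<dots> \<le> (272 / 100) * (1 + 1 / 8 + (1 / 8)\<^sup>2)"
      by (intro mult_mono exp_bound less_imp_le[OF e_less_272]) auto
    also have "\<dots> \<le> 12 / pi" using pi_approx(2) by (simp add: field_simps power2_eq_square)
    finally have "exp (9 / 8) * (pi\<^sup>2 / 6) \<le> 12 / pi * (pi\<^sup>2 / 6)" by (rule mult_right_mono) simp
    thus ?thesis by (simp add: power2_eq_square)
  qed
  have "norm (zeta ?s) = 2 * ((2 * pi) powr \<sigma> / (2 * pi)) * norm (sin (of_real pi * ?s / 2)) * norm (Gamma (1 - ?s)) * norm (dirichlet_sum (1 - ?s))"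
    using assms(1) by (subst zeta_functional_equation) (simp_all add: norm_mult pow del: of_real_mult)
  also have "\<dots> \<le> 2 * ((2 * pi) powr \<sigma> / (2 * pi)) * exp (pi * \<bar>t\<bar> / 2) * (exp (9 / 8) * R * exp (- pi * \<bar>t\<bar> / 2)) * (pi\<^sup>2 / 6)"
    using sin Gamma norm_dirichlet_sum_le[of "1 - ?s"] assms(1)
    by (intro mult_mono mult_nonneg_nonneg) (auto simp: R_def)
  \<comment> \<open>The growth of the sine cancels the decay of \<open>Gamma\<close>, and the factor
    1 / (2 pi) left over from the power with exponent s - 1 absorbs the numerical constant.\<close>
  also have "\<dots> = 2 * (2 * pi) powr \<sigma> * R * ((exp (9 / 8) * (pi\<^sup>2 / 6)) / (2 * pi)) * (exp (pi * \<bar>t\<bar> / 2) * exp (- pi * \<bar>t\<bar> / 2))"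
    by (simp add: mult_ac)
  also have "exp (pi * \<bar>t\<bar> / 2) * exp (- pi * \<bar>t\<bar> / 2) = 1" by (simp flip: exp_add)
  also have "2 * (2 * pi) powr \<sigma> * R * ((exp (9 / 8) * (pi\<^sup>2 / 6)) / (2 * pi)) * 1 \<le> 2 * (2 * pi) powr \<sigma> * R * 1 * 1"
    using const by (intro mult_mono mult_nonneg_nonneg) (auto simp: R_def)
  finally show ?thesis unfolding R by simp
qed

end
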